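(* Assume that: (1) for each $i\in\mathcal I$, $J_i$ is continuously differentiable and convex in $x_i$ for given $x_{-i}$; the set $\mathcal X$ satisfies Slater's condition; and $G$ has full row rank; (2) the pseudo-gradient $F$ is $\mu$-strongly monotone and $\theta$-Lipschitz continuous on $\mathbb R^n$ ($\mu,\theta>0$); (3) the communication graph $\mathcal G$ is undirected and connected. Let $\theta_1\in[\mu,\theta]$ be a Lipschitz constant of the extended pseudo-gradient $\mathbf F$, let $c>\frac{1}{\sigma_2(\mathcal L)}\left(\frac{(\theta+\theta_1)^2}{4\mu}+\theta_1\right)$, and let $\bar\mu$ be the smallest eigenvalue of $$\Psi=\begin{bmatrix}\frac{\mu}{N} & -\frac{\theta+\theta_1}{2\sqrt N}\\ -\frac{\theta+\theta_1}{2\sqrt N} & c\,\sigma_2(\mathcal L)-\theta_1\end{bmatrix}.$$ Consider the dynamics $$\dot{\mathbf x}=-\mathcal R^\top\mathbf F(\mathbf x)-\mathcal R^\top G_d^\top\lambda-c\,\mathbf L\mathbf x,\qquad \dot z=L\lambda,$$ $$\lambda=\operatorname*{arg\,min}_{\lambda\ge0}\ \tfrac12\|G_d^\top\lambda\|^2+\lambda^\top\big[G_d\mathbf F(\mathbf x)+cG_d\mathcal R\mathbf L\mathbf x-\alpha(G_d\mathcal R\mathbf x-H_s)+Lz\big]+\tfrac12\lambda^\top L\lambda .$$ If $\alpha>\frac{(\theta_1+c\,\sigma_{\max}(\mathcal L))^2}{4\bar\mu}$, then for any feasible initial condition $x(0)=\mathcal R\mathbf x(0)\in\mathcal X$, or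 equivalently $\mathbf x(0)\in\hat{\mathcal X}$ (and any $z(0)\in\mathbb R^{Nm}$), the true decision variable $x(t)=\mathcal R\mathbf x(t)$ converges asymptotically (as $t\to\infty$) to the v-GNE of the game, with forward invariance of the constraint set $\mathcal X$, i.e. $x(t)\in\mathcal X$ for all $t\ge 0$.
   Context: Game. There are $N$ players indexed by $\mathcal I=\{1,\dots,N\}$. Player $i$ chooses $x_i\in\mathbb R^{n_i}$; $n=\sum_i n_i$; $x=\mathrm{col}\{x_i\}_{i\in\mathcal I}\in\mathbb R^n$ is the stacked vector and $x_{-i}$ the stacked vector of the decisions of all players other than $i$. Player $i$ has objective $J_i(x_i,x_{-i})$, and local constraint data $g_i\in\mathbb R^{m\times n_i}$, $h_i\in\mathbb R^m$. Put $G=[g_1\ \cdots\ g_N]$, $H=\sum_i h_i$, $\mathcal X=\{x\in\mathbb R^n\mid Gx-H\le 0\}$, $G_d=\mathrm{diag}\{g_i\}_{i\in\mathcal I}$ (block diagonal), $H_s=\mathrm{col}\{h_i\}_{i\in\mathcal I}$. Inequalities between vectors are entrywise. The game is: for each $i$, $\min_{x_i\in\mathbb R^{n_i}} J_i(x_i,x_{-i})$ subject to $(x_i,x_{-i})\in\mathcal X$. A GNE is $x^*$ such that, for all $i$, $x_i^*$ minimizes $J_i(x_i,x_{-i}^* )$ over $x_i$ with $(x_i,x_{-i}^* )\in\mathcal X$. Pseudo-gradient: $F(x)=\mathrm{col}\{\nabla_{x_i}J_i(x_i,x_{-i})\}_{i\in\mathcal I}$. $\mu$-strongly monotone: $(F(x)-F(y))^\top(x-y)\ge\mu\|x-y\|^2$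 for all $x,y\in\mathbb R^n$. $\theta$-Lipschitz: $\|F(x)-F(y)\|\le\theta\|x-y\|$ for all $x,y\in\mathbb R^n$. v-GNE (variational GNE): a GNE that is a solution of VI$(\mathcal X,F)$, i.e. $x^*\in\mathcal X$ with $(x-x^* )^\top F(x^* )\ge0$ for all $x\in\mathcal X$; equivalently, the KKT conditions $\nabla_{x_i}J_i(x_i^*,x_{-i}^* )+g_i^\top\lambda_i^*=0$, $0\le\lambda_i^*\perp(H-Gx^* )\ge0$ hold for all $i$ with identical multipliers $\lambda_i^*=\underline\lambda\in\mathbb R^m_+$. Communication graph: $\mathcal G$ is an undirected weighted graph on $\mathcal I$ with symmetric adjacency matrix $\mathcal A=[a_{ij}]$, $a_{ij}\ge0$, $a_{ii}=0$, $a_{ij}>0$ iff $(i,j)$ is an edge; Laplacian $\mathcal L=\mathrm{diag}\{\mathcal A\mathbf 1_N\}-\mathcal A$, with second smallest eigenvalue $\sigma_2(\mathcal L)$ and largest eigenvalue $\sigma_{\max}(\mathcal L)$; $L=\mathcal L\otimes I_m$, $\mathbf L=\mathcal L\otimes I_n$. Partial information: player $i$ keeps an augmented vector $\mathbf x_i=\mathrm{col}\{\mathbf x_i^1,\dots,\mathbf x_i^{i-1},x_i,\mathbf x_i^{i+1},\dots,\mathbf x_i^N\}\in\mathbb R^n$, where $\mathbf x_i^j\in\mathbb R^{n_j}$ is its estimate of player $j$'s decision; $\mathbf x=\mathrm{col}\{\mathbf x_i\}_{i\in\mathcal I}\in\mathbb R^{Nn}$. $\mathcal R_i=[\,0_{n_i\times\sum_{j<i}n_j}\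 \ I_{n_i}\ \ 0_{n_i\times\sum_{j>i}n_j}\,]$ (so $x_i=\mathcal R_i\mathbf x_i$), $\mathcal R=\mathrm{diag}\{\mathcal R_i\}_{i\in\mathcal I}$ (so $x=\mathcal R\mathbf x$). $\hat{\mathcal X}=\{\mathbf x\in\mathbb R^{Nn}\mid G\mathcal R\mathbf x\le H\}$. Extended pseudo-gradient: $\mathbf F(\mathbf x)=\mathrm{col}\{\nabla_{x_i}J_i(\mathbf x_i)\}_{i\in\mathcal I}$, where $\nabla_{x_i}J_i(\mathbf x_i)$ is the partial gradient of $J_i$ in the $i$-th block evaluated at the profile $\mathbf x_i$. The variables $z=\mathrm{col}\{z_i\}$, $\lambda=\mathrm{col}\{\lambda_i\}$ have $z_i,\lambda_i\in\mathbb R^m$. $c>0$ and $\alpha>0$ are constant parameters. *)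

theory Defs
  imports "HOL-Analysis.Analysis" "HOL-Library.Multiset"
begin

text \<open>
  Index types: 'i for the players, 'k for the n scalar coordinates of the stacked decision vector,
  'm for the rows of the coupling constraint. A map own :: 'k \<Rightarrow> 'i assigns every coordinate to its
  player, so the decision x_i consists of the coordinates k with own k = i and
  n_i = card {k. own k = i}. Vectors indexed by 'i \<times> 'k or 'i \<times> 'm are the stacked vectors
  in R^(N n) and R^(N m). An object of R^(n_i) is embedded in R^n by zero padding.
\<close>

section \<open>Matrices\<close>

definition kron ::
    "real^'b::finite^'a::finite \<Rightarrow> real^'d::finite^'c::finite
       \<Rightarrow> real^('b \<times> 'd)^('a \<times> 'c)" where
  "kron A B = (\<chi> p q. A $ fst p $ fst q * B $ snd p $ snd q)"

definition eigenspace :: "real^'n^'n \<Rightarrow> real \<Rightarrow> (real^'n) set" where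
  "eigenspace A s = {v. A *v v = s *\<^sub>R v}"

definition eigenvalues :: "real^'n^'n \<Rightarrow> real set" where
  "eigenvalues A = {s. \<exists>v. v \<noteq> 0 \<and> v \<in> eigenspace A s}"

text \<open>
  All real eigenvalues in ascending order, each repeated according to the dimension of its
  eigenspace. For a symmetric matrix these are all n eigenvalues with their multiplicities.
\<close>

definition eigenvalue_list :: "real^'n^'n \<Rightarrow> real list" where
  "eigenvalue_list A =
     sorted_list_of_multiset (\<Sum>s\<in>eigenvalues A. replicate_mset (dim (eigenspace A s)) s)"

definition eig_min :: "real^'n^'n \<Rightarrow> real" where
  "eig_min A = hd (eigenvalue_list A)"

definition eig_second :: "real^'n^'n \<Rightarrow> real" where
  "eig_second A = eigenvalue_list A ! 1"

definition eig_max :: "real^'n^'n \<Rightarrow> real" where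
  "eig_max A = last (eigenvalue_list A)"

section \<open>Communication graph\<close>

definition weighted_graph :: "real^'i^'i \<Rightarrow> bool" where
  "weighted_graph W \<longleftrightarrow>
     (\<forall>i j. W $ i $ j = W $ j $ i) \<and> (\<forall>i j. 0 \<le> W $ i $ j) \<and> (\<forall>i. W $ i $ i = 0)"

definition connected_graph :: "real^'i^'i \<Rightarrow> bool" where
  "connected_graph W \<longleftrightarrow> (\<forall>i j. (i, j) \<in> {(i, j). 0 < W $ i $ j}\<^sup>*)"

definition laplacian :: "real^'i^'i \<Rightarrow> real^'i^'i" where
  "laplacian W = (\<chi> i j. if i = j then (W *v 1) $ i else 0) - W"

section \<open>The game\<close>

text \<open>block_upd own i u x is the profile (u_i, x_{-i}).\<close>

definition block_upd :: "('k \<Rightarrow> 'i) \<Rightarrow> 'i \<Rightarrow> real^'k \<Rightarrow> real^'k \<Rightarrow> real^'k" where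
  "block_upd own i u x = (\<chi> k. if own k = i then u $ k else x $ k)"

text \<open>
  The partial gradient in block i at x. As u enters (u_i, x_{-i}) only through its i-th block,
  the gradient below vanishes off this block.
\<close>

definition pgrad :: "('k::finite \<Rightarrow> 'i) \<Rightarrow> 'i \<Rightarrow> (real^'k \<Rightarrow> real) \<Rightarrow> real^'k \<Rightarrow> real^'k" where
  "pgrad own i f x = (THE D. GDERIV (\<lambda>u. f (block_upd own i u x)) x :> D)"

definition C1_in_block :: "('k::finite \<Rightarrow> 'i) \<Rightarrow> 'i \<Rightarrow> (real^'k \<Rightarrow> real) \<Rightarrow> bool" where
  "C1_in_block own i f \<longleftrightarrow>
     (\<forall>x. \<exists>D. continuous_on UNIV D \<and> (\<forall>u. GDERIV (\<lambda>v. f (block_upd own i v x)) u :> D u))"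

definition convex_in_block :: "('k::finite \<Rightarrow> 'i) \<Rightarrow> 'i \<Rightarrow> (real^'k \<Rightarrow> real) \<Rightarrow> bool" where
  "convex_in_block own i f \<longleftrightarrow> (\<forall>x. convex_on UNIV (\<lambda>u. f (block_upd own i u x)))"

definition feasible_set :: "real^'k^'m \<Rightarrow> ('i::finite \<Rightarrow> real^'m) \<Rightarrow> (real^'k) set" where
  "feasible_set G h = {x. G *v x - (\<Sum>i\<in>UNIV. h i) \<le> 0}"

text \<open>Strictness has to be spelled out: the order < on vectors is not strict in every entry.\<close>

definition slater :: "real^'k^'m \<Rightarrow> ('i::finite \<Rightarrow> real^'m) \<Rightarrow> bool" where
  "slater G h \<longleftrightarrow> (\<exists>x. \<forall>r. (G *v x) $ r < (\<Sum>i\<in>UNIV. h i) $ r)"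

definition pseudo_gradient ::
    "('k::finite \<Rightarrow> 'i) \<Rightarrow> ('i \<Rightarrow> real^'k \<Rightarrow> real) \<Rightarrow> real^'k \<Rightarrow> real^'k" where
  "pseudo_gradient own J x = (\<chi> k. pgrad own (own k) (J (own k)) x $ k)"

definition strongly_monotone :: "real \<Rightarrow> (real^'k \<Rightarrow> real^'k) \<Rightarrow> bool" where
  "strongly_monotone \<mu> F \<longleftrightarrow> (\<forall>x y. (F x - F y) \<bullet> (x - y) \<ge> \<mu> * (norm (x - y))\<^sup>2)"

definition is_GNE ::
    "('k::finite \<Rightarrow> 'i::finite) \<Rightarrow> ('i \<Rightarrow> real^'k \<Rightarrow> real) \<Rightarrow> real^'k^'m \<Rightarrow> ('i \<Rightarrow> real^'m)
       \<Rightarrow> real^'k \<Rightarrow> bool" where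
  "is_GNE own J G h xs \<longleftrightarrow> xs \<in> feasible_set G h \<and>
     (\<forall>i u. block_upd own i u xs \<in> feasible_set G h \<longrightarrow> J i xs \<le> J i (block_upd own i u xs))"

definition solves_VI :: "(real^'k) set \<Rightarrow> (real^'k \<Rightarrow> real^'k) \<Rightarrow> real^'k \<Rightarrow> bool" where
  "solves_VI X F xs \<longleftrightarrow> xs \<in> X \<and> (\<forall>x\<in>X. 0 \<le> (x - xs) \<bullet> F xs)"

definition is_vGNE ::
    "('k::finite \<Rightarrow> 'i::finite) \<Rightarrow> ('i \<Rightarrow> real^'k \<Rightarrow> real) \<Rightarrow> real^'k^'m \<Rightarrow> ('i \<Rightarrow> real^'m)
       \<Rightarrow> real^'k \<Rightarrow> bool" where
  "is_vGNE own J G h xs \<longleftrightarrow>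
     is_GNE own J G h xs \<and> solves_VI (feasible_set G h) (pseudo_gradient own J) xs"

section \<open>Partial information\<close>

text \<open>
  A vector xx :: real^('i \<times> 'k) stacks the augmented vectors of the players; xx $ (i, k) is player i's
  estimate of coordinate k, and its own decision if own k = i.
\<close>

definition aug_vec :: "real^('i::finite \<times> 'k::finite) \<Rightarrow> 'i \<Rightarrow> real^'k" where
  "aug_vec xx i = (\<chi> k. xx $ (i, k))"

definition ext_pseudo_gradient ::
    "('k::finite \<Rightarrow> 'i::finite) \<Rightarrow> ('i \<Rightarrow> real^'k \<Rightarrow> real) \<Rightarrow> real^('i \<times> 'k) \<Rightarrow> real^'k" where
  "ext_pseudo_gradient own J xx =
     (\<chi> k. pgrad own (own k) (J (own k)) (aug_vec xx (own k)) $ k)"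

text \<open>The selection matrix R = diag(R_i), picking x_i from the i-th augmented vector.\<close>

definition sel_mat :: "('k::finite \<Rightarrow> 'i::finite) \<Rightarrow> real^('i \<times> 'k)^'k" where
  "sel_mat own = (\<chi> k p. if p = (own k, k) then 1 else 0)"

definition aug_feasible_set ::
    "('k::finite \<Rightarrow> 'i::finite) \<Rightarrow> real^'k^'m \<Rightarrow> ('i \<Rightarrow> real^'m) \<Rightarrow> (real^('i \<times> 'k)) set" where
  "aug_feasible_set own G h = {xx. (G ** sel_mat own) *v xx \<le> (\<Sum>i\<in>UNIV. h i)}"

text \<open>
  G_d = diag(g_i), where g_i consists of the columns of G = [g_1 ... g_N] that belong to player i.
\<close>

definition diag_blocks ::
    "('k::finite \<Rightarrow> 'i::finite) \<Rightarrow> real^'k^'m::finite \<Rightarrow> real^'k^('i \<times> 'm)" where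
  "diag_blocks own G = (\<chi> p k. if own k = fst p then G $ snd p $ k else 0)"

definition stack :: "('i::finite \<Rightarrow> real^'m::finite) \<Rightarrow> real^('i \<times> 'm)" where
  "stack h = (\<chi> p. h (fst p) $ snd p)"

section \<open>The dynamics\<close>

definition qp_cost ::
    "('k::finite \<Rightarrow> 'i::finite) \<Rightarrow> ('i \<Rightarrow> real^'k \<Rightarrow> real) \<Rightarrow> real^'k^'m::finite \<Rightarrow> ('i \<Rightarrow> real^'m)
       \<Rightarrow> real^'i^'i \<Rightarrow> real \<Rightarrow> real \<Rightarrow> real^('i \<times> 'k) \<Rightarrow> real^('i \<times> 'm) \<Rightarrow> real^('i \<times> 'm) \<Rightarrow> real" where
  "qp_cost own J G h W c \<alpha> x z l =
     (let R = sel_mat own; Gd = diag_blocks own G;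
          Lm = kron (laplacian W) (mat 1 :: real^'m^'m);
          Ln = kron (laplacian W) (mat 1 :: real^'k^'k)
      in 1 / 2 * (norm (transpose Gd *v l))\<^sup>2
         + l \<bullet> (Gd *v ext_pseudo_gradient own J x + c *\<^sub>R ((Gd ** R ** Ln) *v x)
                - \<alpha> *\<^sub>R ((Gd ** R) *v x - stack h) + Lm *v z)
         + 1 / 2 * (l \<bullet> (Lm *v l)))"

definition trajectory ::
    "('k::finite \<Rightarrow> 'i::finite) \<Rightarrow> ('i \<Rightarrow> real^'k \<Rightarrow> real) \<Rightarrow> real^'k^'m::finite \<Rightarrow> ('i \<Rightarrow> real^'m)
       \<Rightarrow> real^'i^'i \<Rightarrow> real \<Rightarrow> real
       \<Rightarrow> (real \<Rightarrow> real^('i \<times> 'k)) \<Rightarrow> (real \<Rightarrow> real^('i \<times> 'm)) \<Rightarrow> (real \<Rightarrow> real^('i \<times> 'm)) \<Rightarrow> bool" where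
  "trajectory own J G h W c \<alpha> x z l \<longleftrightarrow>
     (let R = sel_mat own; Gd = diag_blocks own G;
          Lm = kron (laplacian W) (mat 1 :: real^'m^'m);
          Ln = kron (laplacian W) (mat 1 :: real^'k^'k)
      in \<forall>t\<ge>0.
        (x has_vector_derivative
           (- (transpose R *v ext_pseudo_gradient own J (x t))
            - (transpose R ** transpose Gd) *v l t - c *\<^sub>R (Ln *v x t))) (at t within {0..}) \<and>
        (z has_vector_derivative (Lm *v l t)) (at t within {0..}) \<and>
        is_arg_min (qp_cost own J G h W c \<alpha> (x t) (z t)) (\<lambda>v. 0 \<le> v) (l t))"

definition Psi_mat :: "real \<Rightarrow> real \<Rightarrow> real \<Rightarrow> real \<Rightarrow> real \<Rightarrow> nat \<Rightarrow> real^2^2" where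
  "Psi_mat \<mu> \<theta> \<theta>1 c \<sigma>2 N =
     vector [vector [\<mu> / real N, - ((\<theta> + \<theta>1) / (2 * sqrt (real N)))],
             vector [- ((\<theta> + \<theta>1) / (2 * sqrt (real N))), c * \<sigma>2 - \<theta>1]]"

end

theory Submission
  imports Defs
begin

text \<open>
  Let \<open>e\<close> be the stacked estimates minus consensus on the variational equilibrium, and
  \<open>(l\<^sup>*, z\<^sup>*)\<close> an equilibrium of the multiplier variables. The Lyapunov function is
  \<open>V = (\<alpha> \<bar>e\<bar>\<^sup>2 + \<bar>z - z\<^sup>*\<bar>\<^sup>2) / 2\<close>. Splitting \<open>e\<close> into its consensus part and the orthogonal rest shows
  that the extended pseudo-gradient plus the Laplacian coupling is strongly monotone towards the
  equilibrium with constant \<open>\<mu>bar\<close>. The KKT conditions of the quadratic program are monotone in \<open>l\<close>; they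
  trade the indefinite term \<open>\<alpha> (l - l\<^sup>*) \<bullet> G_d R e\<close> of \<open>V'\<close> for \<open>- \<bar>p\<bar>\<^sup>2\<close> plus a cross term in
  \<open>\<bar>e\<bar> \<bar>p\<bar>\<close>, where \<open>p = G_d\<^sup>T (l - l\<^sup>*)\<close>. The lower bound on \<open>\<alpha>\<close> makes
  the resulting quadratic form in \<open>(\<bar>e\<bar>, \<bar>p\<bar>)\<close> negative definite. Forward invariance is the sum
  of the dual feasibility conditions over the players: \<open>(G x - H)' \<le> - \<alpha> (G x - H)\<close>.
\<close>

section \<open>Extreme eigenvalues of symmetric matrices\<close>

lemma inner_matrix_vector:
  fixes A :: "real^'n^'m"
  shows "x \<bullet> (A *v y) = (transpose A *v x) \<bullet> y"
  by (simp add: dot_lmul_matrix)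

lemma symmetric_inner_commute:
  fixes A :: "real^'n^'n"
  assumes "transpose A = A"
  shows "x \<bullet> (A *v y) = (A *v x) \<bullet> y"
  using inner_matrix_vector[of x A y] assms by simp

text \<open>Compactness gives a minimiser \<open>v\<close> of the Rayleigh quotient on the unit
  sphere of \<open>S\<close>; the form \<open>B\<close> is then nonnegative on \<open>S\<close> with
  zero \<open>v\<close>. Working in a subspace serves twice: the whole space yields the smallest
  eigenvalue, the complement of the all-ones vector the second one of a Laplacian.\<close>

lemma symmetric_min_eigenvector:
  fixes A :: "real^'n^'n"
  assumes sym: "transpose A = A" and S: "subspace S" "S \<noteq> {0}"
    and inv: "\<And>v. v \<in> S \<Longrightarrow> A *v v \<in> S"
  obtains m v where "v \<in> S" "v \<noteq> 0" "A *v v = m *\<^sub>R v"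
    "\<And>w. w \<in> S \<Longrightarrow> m * (w \<bullet> w) \<le> w \<bullet> (A *v w)"
proof -
  define K where "K = S \<inter> sphere 0 1"
  have "compact K"
    unfolding K_def using closed_subspace[OF S(1)] by (simp add: closed_Int_compact)
  moreover obtain u where u: "u \<in> S" "u \<noteq> 0"
    using S(2) subspace_0[OF S(1)] by blast
  then have "(1 / norm u) *\<^sub>R u \<in> K"
    by (simp add: K_def S(1) subspace_scale)
  then have "K \<noteq> {}" by blast
  moreover have "continuous_on K (\<lambda>w. w \<bullet> (A *v w))"
    by (intro continuous_on_inner continuous_on_id linear_continuous_on matrix_vector_mul_bounded_linear)
  ultimately obtain v where v: "v \<in> K" and min: "\<And>w. w \<in> K \<Longrightarrow> v \<bullet> (A *v v) \<le> w \<bullet> (A *v w)"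
    using continuous_attains_inf by metis
  define m where "m = v \<bullet> (A *v v)"
  define B where "B w = w \<bullet> (A *v w) - m * (w \<bullet> w)" for w
  have vS: "v \<in> S" "norm v = 1" "v \<noteq> 0" "v \<bullet> v = 1"
    using v by (auto simp: K_def norm_eq_1)
  have B_nonneg: "0 \<le> B w" if "w \<in> S" for w
  proof (cases "w = 0")
    case False
    have "(1 / norm w) *\<^sub>R w \<in> K"
      using that False by (simp add: K_def S(1) subspace_scale)
    from min[OF this] have "m \<le> (w \<bullet> (A *v w)) / (w \<bullet> w)"
      by (simp add: m_def matrix_vector_mult_scaleR dot_square_norm power2_eq_square)
    then show ?thesis
      using False by (simp add: B_def field_simps)
  qed (simp add: B_def)
  \<comment> \<open>The residual of the eigenvector equation. Invariance keeps it in
    \<open>S\<close>, and \<open>B\<close> must not decrease when \<open>v\<close> moves along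
    \<open>- w\<close>.\<close>
  define w where "w = A *v v - m *\<^sub>R v"
  have wS: "w \<in> S"
    unfolding w_def using S(1) inv vS by (simp add: subspace_diff subspace_scale)
  have expand: "B (v - t *\<^sub>R w) = t * (t * B w - 2 * (w \<bullet> w))" for t
  proof -
    have 1: "v \<bullet> (A *v w) = (w + m *\<^sub>R v) \<bullet> w"
      using symmetric_inner_commute[OF sym, of v w] by (simp add: w_def)
    have 2: "w \<bullet> (A *v v) = w \<bullet> (w + m *\<^sub>R v)"
      by (simp add: w_def)
    have 3: "v \<bullet> (A *v v) = m * (v \<bullet> v)"
      using vS by (simp add: m_def)
    show ?thesis
      unfolding B_def matrix_vector_mult_diff_distrib matrix_vector_mult_scaleR
      by (simp add: inner_diff_left inner_diff_right 1 2 3 inner_add_left inner_add_right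
          algebra_simps inner_commute)
  qed
  have "w \<bullet> w \<le> 0"
  proof (rule ccontr)
    assume neg: "\<not> w \<bullet> w \<le> 0"
    \<comment> \<open>Small enough that the linear term of \<open>B (v - t *\<^sub>R w)\<close>
      outweighs the quadratic one; the \<open>+ 1\<close> covers \<open>B w = 0\<close>.\<close>
    define t where "t = (w \<bullet> w) / (B w + 1)"
    have "0 \<le> B w" using B_nonneg wS by blast
    then have t: "0 < t" "t * B w \<le> w \<bullet> w"
      using neg by (auto simp: t_def field_simps)
    have "v - t *\<^sub>R w \<in> S"
      using S(1) vS wS by (simp add: subspace_diff subspace_scale)
    then have "0 \<le> t * (t * B w - 2 * (w \<bullet> w))"
      using B_nonneg expand by metis
    then show False
      using t neg by (simp add: zero_le_mult_iff)
  qed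
  then have "w = 0"
    using inner_gt_zero_iff[of w] by linarith
  then have "A *v v = m *\<^sub>R v"
    by (simp add: w_def)
  moreover have "m * (x \<bullet> x) \<le> x \<bullet> (A *v x)" if "x \<in> S" for x
    using B_nonneg[OF that] by (simp add: B_def)
  ultimately show thesis
    using that vS by blast
qed

text \<open>By symmetry, eigenvectors of distinct eigenvalues are orthogonal, so one choice for each
  eigenvalue is an independent set. Without finiteness the sum in \<open>eigenvalue_list\<close>
  would collapse to the empty multiset.\<close>

lemma finite_eigenvalues:
  fixes A :: "real^'n^'n"
  assumes sym: "transpose A = A"
  shows "finite (eigenvalues A)"
proof -
  define f where "f s = (SOME v. v \<noteq> 0 \<and> v \<in> eigenspace A s)" for s
  have f: "f s \<noteq> 0" "A *v f s = s *\<^sub>R f s" if "s \<in> eigenvalues A" for s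
  proof -
    have "f s \<noteq> 0 \<and> f s \<in> eigenspace A s"
      unfolding f_def by (rule someI_ex) (use that in \<open>simp add: eigenvalues_def\<close>)
    then show "f s \<noteq> 0" "A *v f s = s *\<^sub>R f s"
      by (auto simp: eigenspace_def)
  qed
  have orth: "f s \<bullet> f t = 0" if "s \<in> eigenvalues A" "t \<in> eigenvalues A" "s \<noteq> t" for s t
    using symmetric_inner_commute[OF sym, of "f s" "f t"] f[OF that(1)] f[OF that(2)] that(3) by simp
  have inj: "inj_on f (eigenvalues A)"
    using orth f by (metis inj_onI inner_eq_zero_iff)
  have "independent (f ` eigenvalues A)"
    using orth f by (intro pairwise_orthogonal_independent)
      (auto simp: pairwise_def orthogonal_def)
  then show ?thesis
    using independent_bound inj finite_imageD by blast
qed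

lemma set_mset_sum_replicate:
  assumes "finite I"
  shows "set_mset (\<Sum>s\<in>I. replicate_mset (n s) s) = {s \<in> I. 0 < n s}"
  using assms by (auto simp: set_mset_sum in_replicate_mset)

lemma count_sum_replicate:
  assumes "finite I" "s \<in> I"
  shows "count (\<Sum>s\<in>I. replicate_mset (n s) s) s = n s"
  using assms by (simp add: count_sum)

lemma dim_eigenspace_pos:
  assumes "s \<in> eigenvalues A"
  shows "0 < dim (eigenspace A s)"
proof -
  obtain v where "v \<noteq> 0" "v \<in> eigenspace A s"
    using assms by (auto simp: eigenvalues_def)
  then have "\<not> eigenspace A s \<subseteq> {0}" by blast
  then show ?thesis
    using dim_eq_0 by blast
qed

lemma set_eigenvalue_list:
  fixes A :: "real^'n^'n"
  assumes "transpose A = A"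
  shows "set (eigenvalue_list A) = eigenvalues A"
proof -
  have "set (eigenvalue_list A) =
      set_mset (\<Sum>s\<in>eigenvalues A. replicate_mset (dim (eigenspace A s)) s)"
    by (simp add: eigenvalue_list_def)
  then show ?thesis
    using finite_eigenvalues[OF assms] dim_eigenspace_pos[of _ A]
    unfolding set_mset_sum_replicate[OF finite_eigenvalues[OF assms]] by blast
qed

lemma sorted_eigenvalue_list: "sorted (eigenvalue_list A)"
  by (simp add: eigenvalue_list_def)

lemma symmetric_min_eigenvalue:
  fixes A :: "real^'n^'n"
  assumes "transpose A = A"
  obtains m where "m \<in> eigenvalues A" "\<And>w. m * (w \<bullet> w) \<le> w \<bullet> (A *v w)"
proof -
  have "axis undefined 1 \<noteq> (0 :: real^'n)" by (simp add: axis_eq_0_iff)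
  then have "(UNIV :: (real^'n) set) \<noteq> {0}" by blast
  then show thesis
    by (rule symmetric_min_eigenvector[OF assms subspace_UNIV])
      (use that in \<open>auto simp: eigenvalues_def eigenspace_def\<close>)
qed

text \<open>The Rayleigh minimum is an eigenvalue, hence an entry of the sorted list, so the head of
  the list lies below it.\<close>

lemma eig_min:
  fixes A :: "real^'n^'n"
  assumes sym: "transpose A = A"
  shows eig_min_in_eigenvalues: "eig_min A \<in> eigenvalues A"
    and eig_min_rayleigh: "eig_min A * (w \<bullet> w) \<le> w \<bullet> (A *v w)"
proof -
  obtain m where m: "m \<in> eigenvalues A" "\<And>w. m * (w \<bullet> w) \<le> w \<bullet> (A *v w)"
    using symmetric_min_eigenvalue[OF sym] by blast
  have ne: "eigenvalue_list A \<noteq> []" and mem: "m \<in> set (eigenvalue_list A)"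
    using m set_eigenvalue_list[OF sym] by force+
  show "eig_min A \<in> eigenvalues A"
    using hd_in_set[OF ne] set_eigenvalue_list[OF sym] by (simp add: eig_min_def)
  have "eig_min A \<le> m"
    using ne mem sorted_eigenvalue_list[of A]
    by (cases "eigenvalue_list A") (auto simp: eig_min_def)
  then have "eig_min A * (w \<bullet> w) \<le> m * (w \<bullet> w)"
    by (simp add: mult_right_mono)
  then show "eig_min A * (w \<bullet> w) \<le> w \<bullet> (A *v w)"
    using m(2) order_trans by blast
qed

lemma eigenvalue_le_eig_max:
  fixes A :: "real^'n^'n"
  assumes "transpose A = A" "s \<in> eigenvalues A"
  shows "s \<le> eig_max A"
proof -
  obtain i where i: "i < length (eigenvalue_list A)" "eigenvalue_list A ! i = s"
    using assms set_eigenvalue_list in_set_conv_nth by metis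
  then have "eigenvalue_list A \<noteq> []" by auto
  then show ?thesis
    using i sorted_nth_mono[OF sorted_eigenvalue_list, of i "length (eigenvalue_list A) - 1" A]
    by (simp add: eig_max_def last_conv_nth)
qed

lemma uminus_matrix_vector: "(- A) *v x = - (A *v (x :: real^'n))"
  by (simp add: matrix_vector_mult_def vec_eq_iff sum_negf)

lemma eig_max_rayleigh:
  fixes A :: "real^'n^'n"
  assumes sym: "transpose A = A"
  shows "w \<bullet> (A *v w) \<le> eig_max A * (w \<bullet> w)"
proof -
  have "transpose (- A) = - A"
    using sym by (simp add: transpose_def vec_eq_iff)
  then obtain m where m: "m \<in> eigenvalues (- A)" "\<And>w. m * (w \<bullet> w) \<le> w \<bullet> (- A *v w)"
    using symmetric_min_eigenvalue by blast
  from m(1) obtain v where v: "v \<noteq> 0" "(- A) *v v = m *\<^sub>R v"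
    by (auto simp: eigenvalues_def eigenspace_def)
  then have "A *v v = (- m) *\<^sub>R v"
    by (metis add.inverse_inverse scaleR_minus_left uminus_matrix_vector)
  with v(1) have "- m \<in> eigenvalues A"
    by (auto simp: eigenvalues_def eigenspace_def)
  then have "- m * (w \<bullet> w) \<le> eig_max A * (w \<bullet> w)"
    by (intro mult_right_mono eigenvalue_le_eig_max[OF sym]) auto
  then show ?thesis
    using m(2)[of w] by (simp add: uminus_matrix_vector)
qed

text \<open>No diagonalisation is involved: testing positivity on \<open>v - t *\<^sub>R w\<close>
  with \<open>t = 1 / M\<close> bounds \<open>w \<bullet> w\<close> by
  \<open>M * (v \<bullet> w)\<close>, and the Rayleigh bound for \<open>v\<close> finishes.\<close>

lemma psd_norm_matrix_vector_le:
  fixes A :: "real^'n^'n"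
  assumes sym: "transpose A = A" and psd: "\<And>w. 0 \<le> w \<bullet> (A *v w)"
  shows "norm (A *v v) \<le> eig_max A * norm v"
proof -
  define M where "M = eig_max A"
  define w where "w = A *v v"
  have ray: "x \<bullet> (A *v x) \<le> M * (x \<bullet> x)" for x
    unfolding M_def by (rule eig_max_rayleigh[OF sym])
  have M: "0 \<le> M"
  proof -
    have "0 \<le> M * (axis undefined 1 \<bullet> (axis undefined 1 :: real^'n))"
      using ray psd order_trans by blast
    then show ?thesis by (simp add: inner_axis_axis)
  qed
  have expand: "0 \<le> v \<bullet> w - 2 * t * (w \<bullet> w) + t\<^sup>2 * (w \<bullet> (A *v w))" for t
  proof -
    have "0 \<le> (v - t *\<^sub>R w) \<bullet> (A *v (v - t *\<^sub>R w))"
      by (rule psd)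
    also have "\<dots> = v \<bullet> w - 2 * t * (w \<bullet> w) + t\<^sup>2 * (w \<bullet> (A *v w))"
      using symmetric_inner_commute[OF sym, of v w]
      by (simp add: matrix_vector_mult_diff_distrib matrix_vector_mult_scaleR inner_diff_left
          inner_diff_right power2_eq_square w_def[symmetric] algebra_simps)
    finally show ?thesis .
  qed
  \<comment> \<open>The step \<open>1 / M\<close> is meaningless for \<open>M = 0\<close>; there
    both quadratic forms are nonpositive and the step 1 suffices.\<close>
  have "w \<bullet> w \<le> M * (v \<bullet> w)"
  proof (cases "M = 0")
    case True
    then have "v \<bullet> w \<le> 0" "w \<bullet> (A *v w) \<le> 0"
      using ray[of v] ray[of w] by (simp_all add: w_def)
    then have "w \<bullet> w \<le> 0"
      using expand[of 1] by simp
    then show ?thesis using True by simp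
  next
    case False
    then have "0 < M" using M by simp
    have "0 \<le> M * (v \<bullet> w - 2 * (1 / M) * (w \<bullet> w) + (1 / M)\<^sup>2 * (w \<bullet> (A *v w)))"
      by (rule mult_nonneg_nonneg[OF M expand])
    also have "\<dots> = M * (v \<bullet> w) - 2 * (w \<bullet> w) + (w \<bullet> (A *v w)) / M"
      using \<open>0 < M\<close> by (simp add: field_simps power2_eq_square)
    also have "(w \<bullet> (A *v w)) / M \<le> w \<bullet> w"
      using ray[of w] \<open>0 < M\<close> by (simp add: field_simps)
    finally show ?thesis by simp
  qed
  also have "\<dots> \<le> M * (M * (v \<bullet> v))"
    using ray[of v] M by (simp add: w_def mult_left_mono)
  finally have "(norm w)\<^sup>2 \<le> (M * norm v)\<^sup>2"
    by (simp add: dot_square_norm power2_eq_square algebra_simps)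
  then show ?thesis
    using M by (simp add: w_def M_def abs_le_square_iff[symmetric])
qed

section \<open>The graph Laplacian\<close>

lemma laplacian_mult_component:
  fixes W :: "real^'i^'i"
  shows "(laplacian W *v v) $ i = (\<Sum>j\<in>UNIV. W $ i $ j * (v $ i - v $ j))"
proof -
  have "(laplacian W *v v) $ i =
      (\<Sum>j\<in>UNIV. (if i = j then (W *v 1) $ i else 0) * v $ j) - (\<Sum>j\<in>UNIV. W $ i $ j * v $ j)"
    by (simp add: laplacian_def matrix_vector_mult_def left_diff_distrib sum_subtractf)
  also have "(\<Sum>j\<in>UNIV. (if i = j then (W *v 1) $ i else 0) * v $ j) = (W *v 1) $ i * v $ i"
    by (simp add: if_distrib[of "\<lambda>a. a * _"] cong: if_cong)
  finally show ?thesis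
    by (simp add: matrix_vector_mult_def sum_distrib_right right_diff_distrib sum_subtractf)
qed

lemma transpose_laplacian:
  assumes "weighted_graph W"
  shows "transpose (laplacian W) = laplacian W"
  using assms by (auto simp: transpose_def laplacian_def weighted_graph_def vec_eq_iff)

text \<open>Symmetric weights allow the summation indices to be exchanged; averaging the two
  expressions produces the squares.\<close>

lemma laplacian_quadratic_form:
  fixes W :: "real^'i^'i"
  assumes "weighted_graph W"
  shows "v \<bullet> (laplacian W *v v) = 1 / 2 * (\<Sum>i\<in>UNIV. \<Sum>j\<in>UNIV. W $ i $ j * (v $ i - v $ j)\<^sup>2)"
proof -
  have 1: "v \<bullet> (laplacian W *v v) = (\<Sum>i\<in>UNIV. \<Sum>j\<in>UNIV. W $ i $ j * (v $ i * (v $ i - v $ j)))"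
    by (simp add: inner_vec_def laplacian_mult_component sum_distrib_left algebra_simps)
  also have "\<dots> = (\<Sum>j\<in>UNIV. \<Sum>i\<in>UNIV. W $ i $ j * (v $ i * (v $ i - v $ j)))"
    by (rule sum.swap)
  also have "\<dots> = (\<Sum>i\<in>UNIV. \<Sum>j\<in>UNIV. W $ i $ j * (v $ j * (v $ j - v $ i)))"
    using assms by (simp add: weighted_graph_def)
  finally have "2 * (v \<bullet> (laplacian W *v v)) =
      (\<Sum>i\<in>UNIV. \<Sum>j\<in>UNIV. W $ i $ j * (v $ i * (v $ i - v $ j)))
      + (\<Sum>i\<in>UNIV. \<Sum>j\<in>UNIV. W $ i $ j * (v $ j * (v $ j - v $ i)))"
    using 1 by simp
  also have "\<dots> = (\<Sum>i\<in>UNIV. \<Sum>j\<in>UNIV. W $ i $ j * (v $ i - v $ j)\<^sup>2)"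
    by (simp add: sum.distrib[symmetric] power2_eq_square algebra_simps)
  finally show ?thesis by simp
qed

lemma laplacian_psd:
  fixes W :: "real^'i^'i"
  assumes "weighted_graph W"
  shows "0 \<le> v \<bullet> (laplacian W *v v)"
  unfolding laplacian_quadratic_form[OF assms]
  using assms by (intro mult_nonneg_nonneg sum_nonneg) (auto simp: weighted_graph_def)

text \<open>With nonnegative weights, zero energy forces equality across each edge, and connectivity
  carries it along paths.\<close>

lemma laplacian_kernel_constant:
  fixes W :: "real^'i^'i"
  assumes W: "weighted_graph W" "connected_graph W" and "v \<bullet> (laplacian W *v v) = 0"
  shows "v $ i = v $ j"
proof -
  have nonneg: "0 \<le> W $ a $ b * (v $ a - v $ b)\<^sup>2" for a b
    using W by (simp add: weighted_graph_def)
  have "(\<Sum>i\<in>UNIV. \<Sum>j\<in>UNIV. W $ i $ j * (v $ i - v $ j)\<^sup>2) = 0"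
    using assms laplacian_quadratic_form[OF W(1), of v] by simp
  then have zero: "W $ a $ b * (v $ a - v $ b)\<^sup>2 = 0" for a b
    using nonneg by (simp add: sum_nonneg_eq_0_iff sum_nonneg)
  have edge: "v $ a = v $ b" if "0 < W $ a $ b" for a b
    using zero[of a b] that by simp
  have "(i, j) \<in> {(i, j). 0 < W $ i $ j}\<^sup>*"
    using W(2) by (simp add: connected_graph_def)
  then show ?thesis
    by (induction rule: rtrancl_induct) (auto dest: edge)
qed

lemma laplacian_mult_one: "laplacian W *v 1 = (0 :: real^'i)"
  by (simp add: vec_eq_iff laplacian_mult_component)

lemma sum_eq_inner_one: "(\<Sum>i\<in>UNIV. v $ i) = (1 :: real^'i) \<bullet> v"
  by (simp add: inner_vec_def)

lemma sum_laplacian_mult: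
  fixes W :: "real^'i^'i"
  assumes "weighted_graph W"
  shows "(\<Sum>i\<in>UNIV. (laplacian W *v v) $ i) = 0"
  by (simp add: sum_eq_inner_one symmetric_inner_commute[OF transpose_laplacian[OF assms]]
      laplacian_mult_one)

text \<open>This makes 0 occur exactly once in \<open>eigenvalue_list\<close>, which is what
  identifies the second entry.\<close>

lemma eigenspace_laplacian_0:
  fixes W :: "real^'i^'i"
  assumes "weighted_graph W" "connected_graph W"
  shows "eigenspace (laplacian W) 0 = span {1}"
proof (intro equalityI subsetI)
  fix v assume "v \<in> eigenspace (laplacian W) 0"
  then have "v $ i = v $ j" for i j
    using laplacian_kernel_constant[OF assms] by (simp add: eigenspace_def)
  then have "v = v $ undefined *\<^sub>R 1"
    by (simp add: vec_eq_iff)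
  then show "v \<in> span {1}"
    by (metis span_base span_scale singletonI)
next
  fix v :: "real^'i" assume "v \<in> span {1}"
  then obtain a where "v = a *\<^sub>R 1"
    by (auto simp: span_singleton)
  then show "v \<in> eigenspace (laplacian W) 0"
    by (simp add: eigenspace_def matrix_vector_mult_scaleR laplacian_mult_one)
qed

text \<open>The list starts with exactly one zero, as zero is a simple eigenvalue and none is
  negative; so index 1 holds the least positive eigenvalue. It lies below the Rayleigh minimum over
  vectors of zero sum, which is itself a nonzero eigenvalue.\<close>

lemma eig_second_laplacian:
  fixes W :: "real^'i^'i"
  assumes W: "weighted_graph W" "connected_graph W" and card: "2 \<le> CARD('i)"
  shows eig_second_laplacian_pos: "0 < eig_second (laplacian W)"
    and eig_second_laplacian_rayleigh:
      "(\<Sum>i\<in>UNIV. w $ i) = 0 \<Longrightarrow> eig_second (laplacian W) * (w \<bullet> w) \<le> w \<bullet> (laplacian W *v w)"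
proof -
  let ?L = "laplacian W" and ?one = "1 :: real^'i"
  note sym = transpose_laplacian[OF W(1)]
  have one: "?one \<noteq> 0" by (simp add: vec_eq_iff)
  define S where "S = {w. ?one \<bullet> w = 0}"
  have sub: "subspace S"
    unfolding S_def by (rule subspace_hyperplane)
  \<comment> \<open>Two distinct vertices make the hyperplane \<open>S\<close> nontrivial.\<close>
  obtain a b :: 'i where ab: "a \<noteq> b"
    using card by (metis card_2_iff' ex_card UNIV_I)
  have "axis a 1 - axis b 1 \<in> S"
    by (simp add: S_def inner_diff_right inner_axis)
  moreover have "axis a 1 - axis b 1 \<noteq> (0 :: real^'i)"
    using ab by (simp add: axis_eq_axis)
  ultimately have "S \<noteq> {0}" by blast
  moreover have "?L *v w \<in> S" for w
    using sum_laplacian_mult[OF W(1)] by (simp add: S_def sum_eq_inner_one)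
  ultimately obtain m v where v: "v \<in> S" "v \<noteq> 0" "?L *v v = m *\<^sub>R v"
    and ray: "\<And>w. w \<in> S \<Longrightarrow> m * (w \<bullet> w) \<le> w \<bullet> (?L *v w)"
    using symmetric_min_eigenvector[OF sym sub] by blast
  have nonneg: "0 \<le> s" if s: "s \<in> eigenvalues ?L" for s
  proof -
    from s obtain u where u: "u \<noteq> 0" "?L *v u = s *\<^sub>R u"
      by (auto simp: eigenvalues_def eigenspace_def)
    then have "0 \<le> s * (u \<bullet> u)"
      using laplacian_psd[OF W(1), of u] by simp
    then show ?thesis
      using u(1) by (metis inner_gt_zero_iff zero_le_mult_iff not_le)
  qed
  have m_eig: "m \<in> eigenvalues ?L"
    using v by (auto simp: eigenvalues_def eigenspace_def)
  \<comment> \<open>An eigenvector for zero would be constant, yet \<open>v\<close> is orthogonal to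
    the all-ones vector.\<close>
  have "m \<noteq> 0"
  proof
    assume "m = 0"
    then have "v \<in> span {?one}"
      using v eigenspace_laplacian_0[OF W] by (auto simp: eigenspace_def)
    then obtain r where "v = r *\<^sub>R ?one"
      by (auto simp: span_singleton)
    then show False
      using v one by (simp add: S_def)
  qed
  have zero_eig: "0 \<in> eigenvalues ?L"
    unfolding eigenvalues_def eigenspace_def
    by (intro CollectI exI[of _ ?one]) (simp add: one laplacian_mult_one)
  let ?l = "eigenvalue_list ?L"
  have "count (mset ?l) 0 = dim (eigenspace ?L 0)"
    unfolding eigenvalue_list_def mset_sorted_list_of_multiset
    using finite_eigenvalues[OF sym] zero_eig by (rule count_sum_replicate)
  then have count: "count (mset ?l) 0 = 1"
    using eigenspace_laplacian_0[OF W] one by (simp add: dim_span dim_singleton)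
  have set: "set ?l = eigenvalues ?L"
    by (rule set_eigenvalue_list[OF sym])
  have sorted: "sorted ?l"
    by (rule sorted_eigenvalue_list)
  obtain x xs where l: "?l = x # xs"
    using set zero_eig by (cases ?l) auto
  have x: "x = 0"
    using l set sorted zero_eig nonneg by (metis list.set_intros(1) order_antisym set_ConsD sorted_simps(2))
  then have "0 \<notin> set xs"
    using count l by (simp add: count_eq_zero_iff)
  moreover have "m \<in> set xs"
    using set m_eig l x \<open>m \<noteq> 0\<close> by auto
  ultimately obtain y ys where xs: "xs = y # ys" "y \<noteq> 0"
    by (cases xs) auto
  have second: "eig_second ?L = y"
    by (simp add: eig_second_def l xs)
  have "y \<in> eigenvalues ?L"
    using set l xs by auto
  then show "0 < eig_second ?L"
    using nonneg[of y] xs second by simp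
  have "y \<le> m"
    using \<open>m \<in> set xs\<close> sorted l xs by auto
  then show "eig_second ?L * (w \<bullet> w) \<le> w \<bullet> (?L *v w)" if "(\<Sum>i\<in>UNIV. w $ i) = 0"
    using ray[of w] that second
    by (simp add: S_def sum_eq_inner_one) (metis inner_ge_zero mult_right_mono order_trans)
qed

text \<open>The Fredholm alternative: the part of \<open>y\<close> orthogonal to the range has zero
  energy, so it is constant, and its entries sum to zero. This later supplies the equilibrium value
  of \<open>z\<close>.\<close>

lemma range_laplacian:
  fixes W :: "real^'i^'i"
  assumes W: "weighted_graph W" "connected_graph W" and y: "(\<Sum>i\<in>UNIV. y $ i) = 0"
  obtains z where "laplacian W *v z = y"
proof -
  let ?L = "laplacian W"
  note sym = transpose_laplacian[OF W(1)]
  have span: "span (range ((*v) ?L)) = range ((*v) ?L)"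
    by (simp add: linear_subspace_image span_eq_iff)
  obtain p r where p: "p \<in> range ((*v) ?L)" and r: "\<And>w. w \<in> range ((*v) ?L) \<Longrightarrow> orthogonal r w"
    and y_eq: "y = p + r"
    using orthogonal_subspace_decomp_exists[of "range ((*v) ?L)" y] span by metis
  have "r \<bullet> (?L *v r) = 0"
    using r by (simp add: orthogonal_def)
  then have const: "r $ i = r $ j" for i j
    by (rule laplacian_kernel_constant[OF W])
  have "(\<Sum>i\<in>UNIV. r $ i) = 0"
    using y p sum_laplacian_mult[OF W(1)] by (auto simp: y_eq sum.distrib)
  moreover have "(\<Sum>i\<in>UNIV. r $ i) = real CARD('i) * r $ j" for j
    using sum.cong[OF refl, of UNIV "\<lambda>i. r $ i" "\<lambda>_. r $ j"] const by simp
  ultimately have "r = 0"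
    by (simp add: vec_eq_iff)
  then show thesis
    using p y_eq that by auto
qed

section \<open>Stacked vectors\<close>

text \<open>Grouping by coordinate instead of by player makes \<open>kron A (mat 1)\<close> act as
  \<open>A\<close> on each piece, so facts about the graph transfer slice by slice.\<close>

definition slice :: "real^('i::finite \<times> 'k::finite) \<Rightarrow> 'k \<Rightarrow> real^'i" where
  "slice x k = (\<chi> i. x $ (i, k))"

text \<open>The Kronecker product of the all-ones vector with \<open>u\<close>.\<close>

definition consensus :: "real^'k::finite \<Rightarrow> real^('i::finite \<times> 'k::finite)" where
  "consensus u = (\<chi> p. u $ snd p)"

lemma slice_nth [simp]: "slice x k $ i = x $ (i, k)"
  by (simp add: slice_def)

lemma consensus_nth [simp]: "consensus u $ p = u $ snd p"
  by (simp add: consensus_def)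

lemma sum_prod_UNIV:
  fixes f :: "'a::finite \<times> 'b::finite \<Rightarrow> real"
  shows "(\<Sum>p\<in>UNIV. f p) = (\<Sum>k\<in>UNIV. \<Sum>i\<in>UNIV. f (i, k))"
proof -
  have "(\<Sum>p\<in>UNIV. f p) = (\<Sum>i\<in>UNIV. \<Sum>k\<in>UNIV. f (i, k))"
    by (simp add: sum.cartesian_product UNIV_Times_UNIV[symmetric] del: UNIV_Times_UNIV)
  then show ?thesis
    using sum.swap[of "\<lambda>i k. f (i, k)" UNIV UNIV] by simp
qed

lemma inner_slices:
  fixes x y :: "real^('i::finite \<times> 'k::finite)"
  shows "x \<bullet> y = (\<Sum>k\<in>UNIV. slice x k \<bullet> slice y k)"
  by (simp add: inner_vec_def sum_prod_UNIV)

lemma slice_kron: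
  fixes A :: "real^'i^'i" and x :: "real^('i::finite \<times> 'k::finite)"
  shows "slice (kron A (mat 1) *v x) k = A *v slice x k"
  by (simp add: vec_eq_iff slice_def kron_def matrix_vector_mult_def sum_prod_UNIV mat_def
      if_distrib[of "\<lambda>a. _ * a"] if_distrib[of "\<lambda>a. a * _"] sum.delta cong: if_cong)
     (simp add: sum.swap[of _ UNIV UNIV])

lemma slice_consensus: "slice (consensus u) k = u $ k *\<^sub>R 1"
  by (simp add: vec_eq_iff)

lemma stacked_eqI:
  fixes x y :: "real^('i::finite \<times> 'k::finite)"
  assumes "\<And>k. slice x k = slice y k"
  shows "x = y"
  using assms by (simp add: vec_eq_iff)

lemma transpose_kron_mat1:
  fixes A :: "real^'i^'i"
  shows "transpose (kron A (mat 1 :: real^'k^'k)) = kron (transpose A) (mat 1)"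
  by (auto simp: transpose_def kron_def mat_def vec_eq_iff)

lemma kron_laplacian_consensus:
  fixes W :: "real^'i::finite^'i"
  shows "kron (laplacian W) (mat 1) *v consensus (u :: real^'k::finite) = 0"
  by (rule stacked_eqI)
    (simp add: slice_kron slice_consensus matrix_vector_mult_scaleR laplacian_mult_one vec_eq_iff)

lemma sum_kron_laplacian:
  fixes W :: "real^'i::finite^'i" and z :: "real^('i \<times> 'k::finite)"
  assumes "weighted_graph W"
  shows "(\<Sum>i\<in>UNIV. (kron (laplacian W) (mat 1) *v z) $ (i, k)) = 0"
  using sum_laplacian_mult[OF assms, of "slice z k"] by (simp add: slice_kron[symmetric])

lemma kron_laplacian_psd:
  fixes W :: "real^'i::finite^'i" and x :: "real^('i \<times> 'k::finite)"
  assumes "weighted_graph W"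
  shows "0 \<le> x \<bullet> (kron (laplacian W) (mat 1) *v x)"
  using laplacian_psd[OF assms] by (simp add: inner_slices slice_kron sum_nonneg)

lemma kron_laplacian_rayleigh:
  fixes W :: "real^'i::finite^'i" and x :: "real^('i \<times> 'k::finite)"
  assumes "weighted_graph W" "connected_graph W" "2 \<le> CARD('i)"
    and "\<And>k. (\<Sum>i\<in>UNIV. x $ (i, k)) = 0"
  shows "eig_second (laplacian W) * (x \<bullet> x) \<le> x \<bullet> (kron (laplacian W) (mat 1) *v x)"
  unfolding inner_slices slice_kron sum_distrib_left
  using assms by (intro sum_mono eig_second_laplacian_rayleigh) auto

lemma norm_kron_laplacian_le:
  fixes W :: "real^'i::finite^'i" and x :: "real^('i \<times> 'k::finite)"
  assumes "weighted_graph W"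
  shows "norm (kron (laplacian W) (mat 1) *v x) \<le> eig_max (laplacian W) * norm x"
proof -
  let ?M = "eig_max (laplacian W)"
  have *: "norm (laplacian W *v v) \<le> ?M * norm v" for v
    using psd_norm_matrix_vector_le[OF transpose_laplacian[OF assms] laplacian_psd[OF assms]] .
  have M: "0 \<le> ?M"
    using order_trans[OF norm_ge_zero *[of 1]] by (simp add: zero_le_mult_iff)
  have "(norm (kron (laplacian W) (mat 1) *v x))\<^sup>2 = (\<Sum>k\<in>UNIV. (norm (laplacian W *v slice x k))\<^sup>2)"
    by (simp add: dot_square_norm[symmetric] inner_slices slice_kron)
  also have "\<dots> \<le> (\<Sum>k\<in>UNIV. (?M * norm (slice x k))\<^sup>2)"
    by (intro sum_mono power_mono *) simp
  also have "\<dots> = (?M * norm x)\<^sup>2"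
    by (simp add: power_mult_distrib sum_distrib_left[symmetric] dot_square_norm[symmetric]
        inner_slices[of x x])
  finally show ?thesis
    using M by (simp add: abs_le_square_iff[symmetric])
qed

lemma range_kron_laplacian:
  fixes W :: "real^'i::finite^'i" and q :: "real^('i \<times> 'k::finite)"
  assumes W: "weighted_graph W" "connected_graph W"
    and q: "\<And>k. (\<Sum>i\<in>UNIV. q $ (i, k)) = 0"
  obtains z where "kron (laplacian W) (mat 1) *v z = q"
proof -
  have "\<exists>z. laplacian W *v z = slice q k" for k
    using range_laplacian[OF W, of "slice q k"] q by auto
  then obtain z where z: "\<And>k. laplacian W *v z k = slice q k"
    by metis
  have "slice (\<chi> p. z (snd p) $ fst p) k = z k" for k
    by (simp add: vec_eq_iff)
  then have "kron (laplacian W) (mat 1) *v (\<chi> p. z (snd p) $ fst p) = q"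
    by (intro stacked_eqI) (simp add: slice_kron z)
  then show thesis
    by (rule that)
qed

section \<open>Variational inequality and equilibrium\<close>

lemma mem_feasible_set: "x \<in> feasible_set G h \<longleftrightarrow> (\<forall>r. (G *v x) $ r \<le> (\<Sum>i\<in>UNIV. h i) $ r)"
  by (simp add: feasible_set_def less_eq_vec_def)

lemma feasible_set_halfspaces:
  "feasible_set G h = (\<Inter>r. {x. G $ r \<bullet> x \<le> (\<Sum>i\<in>UNIV. h i) $ r})"
  by (auto simp: mem_feasible_set matrix_vector_mul_component)

lemma convex_feasible_set: "convex (feasible_set G h)"
  unfolding feasible_set_halfspaces by (intro convex_INT convex_halfspace_le)

lemma closed_feasible_set: "closed (feasible_set G h)"
  unfolding feasible_set_halfspaces by (intro closed_INT ballI closed_halfspace_le)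

text \<open>Each solution is tested against the other; the sum of the two inequalities meets strong
  monotonicity.\<close>

lemma solves_VI_unique:
  assumes "strongly_monotone \<mu> F" "0 < \<mu>" "solves_VI X F x" "solves_VI X F y"
  shows "x = y"
proof -
  have "0 \<le> (y - x) \<bullet> F x" "0 \<le> (x - y) \<bullet> F y"
    using assms by (auto simp: solves_VI_def)
  then have "(F x - F y) \<bullet> (x - y) \<le> 0"
    by (simp add: inner_diff_left inner_diff_right inner_commute)
  then have "\<mu> * (norm (x - y))\<^sup>2 \<le> 0"
    using assms(1) by (meson strongly_monotone_def order_trans)
  then show ?thesis
    using assms(2) by (simp add: mult_le_0_iff)
qed

text \<open>With step \<open>\<mu> / \<theta>\<^sup>2\<close> the projected gradient map is a contraction of constant
  \<open>sqrt (1 - \<mu>\<^sup>2 / \<theta>\<^sup>2)\<close>.\<close>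

lemma solves_VI_exists:
  fixes F :: "real^'k \<Rightarrow> real^'k"
  assumes X: "convex X" "closed X" "X \<noteq> {}"
    and mono: "strongly_monotone \<mu> F" and lip: "\<theta>-lipschitz_on UNIV F"
    and \<mu>: "0 < \<mu>" "\<mu> \<le> \<theta>"
  obtains x where "solves_VI X F x"
proof -
  define \<tau> where "\<tau> = \<mu> / \<theta>\<^sup>2"
  define q where "q = sqrt (1 - \<mu>\<^sup>2 / \<theta>\<^sup>2)"
  define T where "T x = closest_point X (x - \<tau> *\<^sub>R F x)" for x
  have \<theta>: "0 < \<theta>" using \<mu> by simp
  have \<tau>: "0 < \<tau>" using \<mu> \<theta> by (simp add: \<tau>_def)
  have ratio: "\<mu>\<^sup>2 / \<theta>\<^sup>2 \<le> 1" "0 < \<mu>\<^sup>2 / \<theta>\<^sup>2"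
    using \<mu> \<theta> by (simp_all add: power_mono)
  have q: "0 \<le> q" "q < 1" "q\<^sup>2 = 1 - \<mu>\<^sup>2 / \<theta>\<^sup>2"
    unfolding q_def using ratio by simp_all
  have contr: "dist (T x) (T y) \<le> q * dist x y" for x y
  proof -
    let ?d = "x - y" and ?g = "F x - F y"
    have "norm ?g \<le> \<theta> * norm ?d"
      using lipschitz_onD[OF lip, of x y] by (simp add: dist_norm)
    then have g: "(norm ?g)\<^sup>2 \<le> \<theta>\<^sup>2 * (norm ?d)\<^sup>2"
      by (metis norm_ge_zero power_mono power_mult_distrib)
    have m: "\<mu> * (norm ?d)\<^sup>2 \<le> ?g \<bullet> ?d"
      using mono by (simp add: strongly_monotone_def)
    have "(norm (?d - \<tau> *\<^sub>R ?g))\<^sup>2 = (norm ?d)\<^sup>2 - 2 * \<tau> * (?g \<bullet> ?d) + \<tau>\<^sup>2 * (norm ?g)\<^sup>2"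
      unfolding dot_square_norm[symmetric] inner_diff_left inner_diff_right
      by (simp add: inner_commute power2_eq_square algebra_simps)
    also have "\<dots> \<le> (norm ?d)\<^sup>2 - 2 * \<tau> * (\<mu> * (norm ?d)\<^sup>2) + \<tau>\<^sup>2 * (\<theta>\<^sup>2 * (norm ?d)\<^sup>2)"
      using m g \<tau> by (intro add_mono diff_mono mult_left_mono) auto
    also have "\<dots> = (1 - 2 * (\<tau> * \<mu>) + \<tau>\<^sup>2 * \<theta>\<^sup>2) * (norm ?d)\<^sup>2"
      by (simp add: algebra_simps)
    \<comment> \<open>The chosen step length is the minimiser of this quadratic in
      \<open>\<tau>\<close>.\<close>
    also have "1 - 2 * (\<tau> * \<mu>) + \<tau>\<^sup>2 * \<theta>\<^sup>2 = q\<^sup>2"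
    proof -
      have "\<tau> * \<mu> = \<mu>\<^sup>2 / \<theta>\<^sup>2" "\<tau>\<^sup>2 * \<theta>\<^sup>2 = \<mu>\<^sup>2 / \<theta>\<^sup>2"
        using \<theta> by (simp_all add: \<tau>_def power2_eq_square)
      then show ?thesis
        by (simp add: q(3))
    qed
    finally have "(norm (?d - \<tau> *\<^sub>R ?g))\<^sup>2 \<le> (q * norm ?d)\<^sup>2"
      by (simp only: power_mult_distrib)
    then have "norm (?d - \<tau> *\<^sub>R ?g) \<le> q * norm ?d"
      by (rule power2_le_imp_le) (intro mult_nonneg_nonneg q(1) norm_ge_zero)
    moreover have "dist (T x) (T y) \<le> dist (x - \<tau> *\<^sub>R F x) (y - \<tau> *\<^sub>R F y)"
      unfolding T_def using X by (intro closest_point_lipschitz)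
    ultimately show ?thesis
      by (simp add: dist_norm algebra_simps)
  qed
  have "\<exists>!x\<in>X. T x = x"
  proof (rule Banach_fix)
    show "complete X" using X by (simp add: complete_eq_closed)
    show "T ` X \<subseteq> X"
      unfolding T_def by (intro image_subsetI closest_point_in_set[OF X(2,3)])
    show "0 \<le> q" "q < 1" by (rule q)+
    show "dist (T x) (T y) \<le> q * dist x y" for x y by (rule contr)
  qed (use X in auto)
  then obtain x where x: "x \<in> X" "closest_point X (x - \<tau> *\<^sub>R F x) = x"
    by (auto simp: T_def)
  \<comment> \<open>At a fixed point, the obtuse-angle property of the projection is the variational
    inequality scaled by \<open>\<tau>\<close>.\<close>
  have "0 \<le> (y - x) \<bullet> F x" if "y \<in> X" for y
  proof -
    have "(x - \<tau> *\<^sub>R F x - x) \<bullet> (y - x) \<le> 0"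
      using closest_point_dot[OF X(1,2) that, of "x - \<tau> *\<^sub>R F x"] x by simp
    then have "0 \<le> \<tau> * ((y - x) \<bullet> F x)"
      by (simp add: inner_commute)
    then show ?thesis
      using \<tau> by (simp add: zero_le_mult_iff)
  qed
  then show thesis
    using x that by (auto simp: solves_VI_def)
qed

text \<open>Full row rank lets the steps \<open>d\<close> below realise every value of \<open>G d\<close>, which replaces
  the Farkas lemma.\<close>

lemma solves_VI_multiplier:
  fixes G :: "real^'k^'m" and h :: "'i::finite \<Rightarrow> real^'m"
  assumes rank: "rank G = CARD('m)" and VI: "solves_VI (feasible_set G h) F x"
  obtains l where "F x + transpose G *v l = 0" "0 \<le> l" "l \<bullet> ((\<Sum>i\<in>UNIV. h i) - G *v x) = 0"
proof -
  let ?H = "\<Sum>i\<in>UNIV. h i"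
  have surj: "\<exists>d. G *v d = y" for y
    using rank full_rank_surjective[of G] by (metis surj_def)
  have step: "0 \<le> d \<bullet> F x" if "\<And>r. (G *v d) $ r \<le> (?H - G *v x) $ r" for d
  proof -
    have "x + d \<in> feasible_set G h"
      using that by (simp add: mem_feasible_set matrix_vector_right_distrib algebra_simps)
    then have "0 \<le> (x + d - x) \<bullet> F x"
      using VI by (auto simp: solves_VI_def)
    then show ?thesis by simp
  qed
  have slack: "0 \<le> (?H - G *v x) $ r" for r
    using VI by (simp add: solves_VI_def mem_feasible_set)
  \<comment> \<open>Here \<open>n\<close> is the part of \<open>F x\<close> that no multiplier can
    produce. It lies in the kernel of \<open>G\<close>, so moving by \<open>- n\<close> keeps
    feasibility and the variational inequality forces \<open>n = 0\<close>.\<close>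
  obtain p n where p: "p \<in> range ((*v) (transpose G))"
    and n: "\<And>w. w \<in> range ((*v) (transpose G)) \<Longrightarrow> orthogonal n w" and F: "F x = p + n"
    using orthogonal_subspace_decomp_exists[of "range ((*v) (transpose G))" "F x"]
    by (metis span_eq_iff linear_subspace_image subspace_UNIV matrix_vector_mul_linear)
  have "n \<bullet> (transpose G *v (G *v n)) = 0"
    using n by (simp add: orthogonal_def del: transpose_matrix_vector)
  then have "(G *v n) \<bullet> (G *v n) = 0"
    by (simp only: inner_matrix_vector[of n "transpose G"] transpose_transpose)
  then have Gn: "G *v n = 0" by simp
  then have "0 \<le> (- n) \<bullet> F x"
    using slack matrix_vector_mult_scaleR[of G "-1" n] by (intro step) simp
  moreover have "n \<bullet> p = 0"
    using n p by (simp add: orthogonal_def)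
  ultimately have "n \<bullet> n \<le> 0"
    by (simp add: F inner_add_right)
  then have "n = 0"
    using inner_gt_zero_iff[of n] by linarith
  with p F obtain l0 where "F x = transpose G *v l0" by auto
  then have l: "F x + transpose G *v (- l0) = 0"
    using matrix_vector_mult_scaleR[of "transpose G" "-1" l0] by simp
  have dF: "d \<bullet> F x = (G *v d) \<bullet> l0" for d
    by (simp only: \<open>F x = transpose G *v l0\<close> inner_matrix_vector transpose_transpose)
  have "0 \<le> (- l0) $ r" for r
  proof -
    \<comment> \<open>A step that lowers constraint \<open>r\<close> alone tests the sign of its
      multiplier.\<close>
    obtain d where d: "G *v d = - axis r 1"
      using surj by metis
    have "0 \<le> d \<bullet> F x"
      using slack order_trans[OF _ slack] by (intro step) (auto simp: d axis_def)
    then show ?thesis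
      by (simp add: dF d inner_axis')
  qed
  then have l_nonneg: "0 \<le> - l0"
    by (simp add: less_eq_vec_def)
  \<comment> \<open>The step that makes every constraint active gives complementary
    slackness.\<close>
  obtain d where d: "G *v d = ?H - G *v x"
    using surj by metis
  have "0 \<le> d \<bullet> F x"
    by (rule step) (simp add: d)
  then have "(- l0) \<bullet> (?H - G *v x) \<le> 0"
    by (simp add: dF d inner_commute)
  moreover have "0 \<le> (- l0) \<bullet> (?H - G *v x)"
    unfolding inner_vec_def using slack l_nonneg
    by (intro sum_nonneg) (auto simp: less_eq_vec_def intro: mult_nonneg_nonneg mult_nonpos_nonneg)
  ultimately show thesis
    using that[OF l l_nonneg] by simp
qed

section \<open>Partial gradients and Nash equilibria\<close>

lemma GDERIV_unique:
  assumes "GDERIV f x :> D" "GDERIV f x :> E"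
  shows "D = E"
proof -
  have "(\<lambda>h. h \<bullet> D) = (\<lambda>h. h \<bullet> E)"
    using assms unfolding gderiv_def by (rule has_derivative_unique)
  then show ?thesis
    by (metis inner_commute vector_eq_ldot)
qed

lemma GDERIV_pgrad:
  assumes "C1_in_block own i f"
  shows "GDERIV (\<lambda>u. f (block_upd own i u x)) x :> pgrad own i f x"
proof -
  obtain D where D: "GDERIV (\<lambda>u. f (block_upd own i u x)) x :> D"
    using assms unfolding C1_in_block_def by metis
  show ?thesis
    unfolding pgrad_def using D by (rule theI) (rule GDERIV_unique[OF _ D])
qed

text \<open>Restriction to the line through \<open>x\<close> and \<open>u\<close> reduces this to
  the tangent inequality in one variable.\<close>

lemma convex_on_above_gradient:
  fixes f :: "real^'k \<Rightarrow> real"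
  assumes conv: "convex_on UNIV f" and D: "GDERIV f x :> D"
  shows "(u - x) \<bullet> D \<le> f u - f x"
proof -
  define \<phi> where "\<phi> s = f (x + s *\<^sub>R (u - x))" for s :: real
  have "convex_on UNIV \<phi>"
    unfolding \<phi>_def
  proof (rule convex_onI)
    fix t a b :: real assume t: "0 < t" "t < 1"
    have "x + ((1 - t) *\<^sub>R a + t *\<^sub>R b) *\<^sub>R (u - x) =
        (1 - t) *\<^sub>R (x + a *\<^sub>R (u - x)) + t *\<^sub>R (x + b *\<^sub>R (u - x))"
      by (simp add: algebra_simps)
    then show "f (x + ((1 - t) *\<^sub>R a + t *\<^sub>R b) *\<^sub>R (u - x)) \<le>
        (1 - t) * f (x + a *\<^sub>R (u - x)) + t * f (x + b *\<^sub>R (u - x))"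
      using convex_onD[OF conv, of t] t by simp
  qed simp
  moreover have "(\<phi> has_field_derivative (u - x) \<bullet> D) (at 0 within UNIV)"
  proof -
    have f: "(f has_derivative (\<lambda>h. h \<bullet> D)) (at (x + 0 *\<^sub>R (u - x)))"
      using D by (simp add: gderiv_def)
    have g: "((\<lambda>s. x + s *\<^sub>R (u - x)) has_derivative (\<lambda>s. s *\<^sub>R (u - x))) (at 0)"
      by (auto intro!: derivative_eq_intros)
    have "(\<phi> has_derivative (\<lambda>s. (s *\<^sub>R (u - x)) \<bullet> D)) (at 0)"
      using has_derivative_compose[OF g f] by (simp add: \<phi>_def[abs_def])
    moreover have "(\<lambda>s. (s *\<^sub>R (u - x)) \<bullet> D) = (*) ((u - x) \<bullet> D)"
      by (simp add: fun_eq_iff)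
    ultimately show ?thesis
      by (simp add: has_field_derivative_def)
  qed
  ultimately have "((u - x) \<bullet> D) * (1 - 0) \<le> \<phi> 1 - \<phi> 0"
    by (intro convex_on_imp_above_tangent[where A = UNIV]) auto
  then show ?thesis
    by (simp add: \<phi>_def)
qed

lemma block_upd_self: "block_upd own i x x = x"
  by (simp add: block_upd_def vec_eq_iff)

lemma block_upd_idem: "block_upd own i (block_upd own i u x) x = block_upd own i u x"
  by (simp add: block_upd_def vec_eq_iff)

text \<open>Unilateral deviations are admissible test points, and only the block of the deviating
  player survives in the inner product. Convexity then turns the partial gradient into a bound on
  the cost.\<close>

lemma solves_VI_imp_GNE:
  fixes own :: "'k::finite \<Rightarrow> 'i::finite"
  assumes C1: "\<And>i. C1_in_block own i (J i)" and conv: "\<And>i. convex_in_block own i (J i)"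
    and VI: "solves_VI (feasible_set G h) (pseudo_gradient own J) x"
  shows "is_GNE own J G h x"
  unfolding is_GNE_def
proof (intro conjI allI impI)
  show "x \<in> feasible_set G h"
    using VI by (simp add: solves_VI_def)
  fix i u assume feas: "block_upd own i u x \<in> feasible_set G h"
  let ?y = "block_upd own i u x"
  have "0 \<le> (?y - x) \<bullet> pseudo_gradient own J x"
    using VI feas by (auto simp: solves_VI_def)
  also have "\<dots> = (?y - x) \<bullet> pgrad own i (J i) x"
    unfolding inner_vec_def by (rule sum.cong) (auto simp: block_upd_def pseudo_gradient_def)
  also have "\<dots> \<le> J i (block_upd own i ?y x) - J i (block_upd own i x x)"
    using conv[of i] GDERIV_pgrad[OF C1]
    by (intro convex_on_above_gradient) (auto simp: convex_in_block_def)
  finally show "J i x \<le> J i ?y"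
    by (simp add: block_upd_self block_upd_idem)
qed

section \<open>Restricted monotonicity of the extended pseudo-gradient\<close>

lemma sel_mat_nth: "(sel_mat own *v x) $ k = x $ (own k, k)"
  by (simp add: sel_mat_def matrix_vector_mult_def if_distrib[of "\<lambda>a. a * _"] cong: if_cong)

lemma transpose_sel_mat_nth: "(u v* sel_mat own) $ p = (if own (snd p) = fst p then u $ snd p else 0)"
proof -
  obtain i j where p: "p = (i, j)" by force
  have "(u v* sel_mat own) $ p = (\<Sum>k\<in>UNIV. u $ k * (if p = (own k, k) then 1 else 0))"
    by (simp add: sel_mat_def vector_matrix_mult_def mult.commute)
  also have "\<dots> = (\<Sum>k\<in>UNIV. if k = j then (if own k = i then u $ k else 0) else 0)"
    by (rule sum.cong) (auto simp: p)
  finally show ?thesis by (simp add: p)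
qed

lemma sel_mat_transpose: "sel_mat own *v (u v* sel_mat own) = u"
  by (simp add: vec_eq_iff sel_mat_nth transpose_sel_mat_nth)

lemma inner_transpose_sel_mat: "x \<bullet> (u v* sel_mat own) = (sel_mat own *v x) \<bullet> u"
  using dot_lmul_matrix[of u "sel_mat own" x] by (simp add: inner_commute)

lemma norm_transpose_sel_mat: "norm (u v* sel_mat own) = norm u"
  by (simp add: norm_eq_sqrt_inner inner_transpose_sel_mat sel_mat_transpose)

text \<open>The transpose is an isometry, because the selection matrix is its left inverse;
  Cauchy-Schwarz then gives the contraction.\<close>

lemma norm_sel_mat_le: "norm (sel_mat own *v x) \<le> norm x"
proof -
  let ?u = "sel_mat own *v x"
  have "(norm ?u)\<^sup>2 = x \<bullet> (?u v* sel_mat own)"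
    by (simp add: inner_transpose_sel_mat dot_square_norm)
  also have "\<dots> \<le> norm x * norm ?u"
    using norm_cauchy_schwarz norm_transpose_sel_mat by metis
  finally show ?thesis
    by (cases "?u = 0") (auto simp: power2_eq_square)
qed

lemma sel_mat_consensus: "sel_mat own *v consensus u = u"
  by (simp add: vec_eq_iff sel_mat_nth)

lemma inner_consensus:
  fixes x :: "real^('i::finite \<times> 'k::finite)"
  shows "x \<bullet> consensus u = (\<Sum>k\<in>UNIV. (\<Sum>i\<in>UNIV. x $ (i, k)) * u $ k)"
  by (simp add: inner_vec_def sum_prod_UNIV sum_distrib_right)

lemma ext_pseudo_gradient_consensus:
  fixes own :: "'k::finite \<Rightarrow> 'i::finite"
  shows "ext_pseudo_gradient own J (consensus u) = pseudo_gradient own J u"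
proof -
  have "aug_vec (consensus u) i = u" for i :: 'i
    by (simp add: aug_vec_def vec_eq_iff)
  then show ?thesis
    by (simp add: ext_pseudo_gradient_def pseudo_gradient_def)
qed

lemma sel_mat_feasible_iff:
  "sel_mat own *v x \<in> feasible_set G h \<longleftrightarrow> x \<in> aug_feasible_set own G h"
  by (simp add: aug_feasible_set_def mem_feasible_set less_eq_vec_def matrix_vector_mul_assoc)

section \<open>The matrix Psi and its definiteness\<close>

lemma transpose_Psi_mat: "transpose (Psi_mat \<mu> \<theta> \<theta>1 c \<sigma> N) = Psi_mat \<mu> \<theta> \<theta>1 c \<sigma> N"
  by (simp add: Psi_mat_def transpose_def vec_eq_iff forall_2)

lemma Psi_mat_quadratic_form:
  fixes v :: "real^2"
  shows "v \<bullet> (Psi_mat \<mu> \<theta> \<theta>1 c \<sigma> N *v v) =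
    \<mu> / real N * (v $ 1)\<^sup>2 - (\<theta> + \<theta>1) / sqrt (real N) * (v $ 1 * v $ 2) + (c * \<sigma> - \<theta>1) * (v $ 2)\<^sup>2"
  by (simp add: Psi_mat_def inner_vec_def matrix_vector_mult_def sum_2 power2_eq_square
      field_simps)

text \<open>Multiplication by \<open>a\<close> completes the square and leaves the determinant as
  the coefficient of \<open>y\<^sup>2\<close>.\<close>

lemma quadratic_form_2_pos:
  fixes a b d x y :: real
  assumes "0 < a" "b\<^sup>2 < a * d" "x \<noteq> 0 \<or> y \<noteq> 0"
  shows "0 < a * x\<^sup>2 - 2 * b * (x * y) + d * y\<^sup>2"
proof -
  have "a * (a * x\<^sup>2 - 2 * b * (x * y) + d * y\<^sup>2) = (a * x - b * y)\<^sup>2 + (a * d - b\<^sup>2) * y\<^sup>2"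
    by (simp add: power2_eq_square algebra_simps)
  moreover have "0 < (a * x - b * y)\<^sup>2 + (a * d - b\<^sup>2) * y\<^sup>2"
    using assms by (cases "y = 0") (auto intro: add_nonneg_pos)
  ultimately show ?thesis
    using assms(1) by (metis zero_less_mult_pos)
qed

text \<open>The lower bound on \<open>c\<close> says precisely that the determinant of
  \<open>Psi_mat\<close> is positive. The form is then positive at an eigenvector of
  \<open>eig_min\<close>.\<close>

lemma eig_min_Psi_pos:
  assumes N: "0 < N" and \<mu>: "0 < \<mu>" and \<sigma>: "0 < \<sigma>"
    and c: "1 / \<sigma> * ((\<theta> + \<theta>1)\<^sup>2 / (4 * \<mu>) + \<theta>1) < c"
  shows "0 < eig_min (Psi_mat \<mu> \<theta> \<theta>1 c \<sigma> N)"
proof -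
  let ?P = "Psi_mat \<mu> \<theta> \<theta>1 c \<sigma> N"
  have "(\<theta> + \<theta>1)\<^sup>2 / (4 * \<mu>) + \<theta>1 < c * \<sigma>"
    using c \<sigma> by (simp add: field_simps)
  then have c': "(\<theta> + \<theta>1)\<^sup>2 < 4 * \<mu> * (c * \<sigma> - \<theta>1)"
    using \<mu> by (simp add: field_simps)
  obtain v where v: "v \<noteq> 0" "?P *v v = eig_min ?P *\<^sub>R v"
    using eig_min_in_eigenvalues[OF transpose_Psi_mat, of \<mu> \<theta> \<theta>1 c \<sigma> N]
    by (auto simp: eigenvalues_def eigenspace_def)
  let ?b = "(\<theta> + \<theta>1) / (2 * sqrt (real N))"
  have "?b\<^sup>2 = (\<theta> + \<theta>1)\<^sup>2 / (4 * real N)"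
    using N by (simp add: power_divide power_mult_distrib)
  also have "\<dots> < 4 * \<mu> * (c * \<sigma> - \<theta>1) / (4 * real N)"
    using c' N by (intro divide_strict_right_mono) simp_all
  finally have "?b\<^sup>2 < \<mu> / real N * (c * \<sigma> - \<theta>1)"
    by simp
  moreover have "v $ 1 \<noteq> 0 \<or> v $ 2 \<noteq> 0"
    using v(1) by (auto simp: vec_eq_iff forall_2)
  moreover have "0 < \<mu> / real N" using \<mu> N by simp
  ultimately have "0 < \<mu> / real N * (v $ 1)\<^sup>2 - 2 * ?b * (v $ 1 * v $ 2) + (c * \<sigma> - \<theta>1) * (v $ 2)\<^sup>2"
    by (intro quadratic_form_2_pos)
  also have "\<dots> = v \<bullet> (?P *v v)"
    unfolding Psi_mat_quadratic_form using N by (simp add: field_simps)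
  also have "\<dots> = eig_min ?P * (v \<bullet> v)"
    by (simp add: v(2))
  finally show ?thesis
    using v(1) by (metis inner_ge_zero zero_less_mult_pos2 inner_gt_zero_iff)
qed

text \<open>The comparison runs through the average profile \<open>y = u + m\<close>. Between
  \<open>y\<close> and \<open>u\<close> strong monotonicity acts on \<open>m\<close>; between
  \<open>x\<close> and \<open>consensus y\<close> only the disagreement \<open>d\<close> enters; and
  the Laplacian term controls \<open>d\<close>, which has zero sum over the players.\<close>

lemma ext_pseudo_gradient_restricted_monotone:
  fixes own :: "'k::finite \<Rightarrow> 'i::finite" and W :: "real^'i^'i"
    and x :: "real^('i \<times> 'k)" and u :: "real^'k"
  assumes card: "2 \<le> CARD('i)"
    and mono: "strongly_monotone \<mu> (pseudo_gradient own J)"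
    and lip: "\<theta>-lipschitz_on UNIV (pseudo_gradient own J)"
    and lip_ext: "\<theta>1-lipschitz_on UNIV (ext_pseudo_gradient own J)"
    and W: "weighted_graph W" "connected_graph W" and c: "0 \<le> c"
  defines "e \<equiv> x - consensus u"
  shows "eig_min (Psi_mat \<mu> \<theta> \<theta>1 c (eig_second (laplacian W)) CARD('i)) * (norm e)\<^sup>2
    \<le> (sel_mat own *v e) \<bullet> (ext_pseudo_gradient own J x - pseudo_gradient own J u)
      + c * (e \<bullet> (kron (laplacian W) (mat 1) *v e))"
proof -
  let ?N = "real CARD('i)" and ?\<sigma> = "eig_second (laplacian W)" and ?R = "sel_mat own"
    and ?F = "pseudo_gradient own J" and ?E = "ext_pseudo_gradient own J"
  let ?P = "Psi_mat \<mu> \<theta> \<theta>1 c ?\<sigma> CARD('i)"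
  let ?L = "kron (laplacian W) (mat 1) :: real^('i \<times> 'k)^('i \<times> 'k)"
  have N: "0 < ?N" by simp
  define m :: "real^'k" where "m = (\<chi> k. (\<Sum>i\<in>UNIV. e $ (i, k)) / ?N)"
  define d where "d = e - consensus m"
  have sum_d: "(\<Sum>i\<in>UNIV. d $ (i, k)) = 0" for k
    by (simp add: d_def m_def sum_subtractf)
  have d_orth: "d \<bullet> consensus v = 0" for v
    by (simp add: inner_consensus sum_d)
  have norm_consensus: "(norm (consensus m :: real^('i \<times> 'k)))\<^sup>2 = ?N * (norm m)\<^sup>2"
    by (simp add: dot_square_norm[symmetric] inner_consensus sum_distrib_left)
      (simp add: inner_vec_def sum_distrib_left mult.assoc)
  have e: "e = consensus m + d" by (simp add: d_def)
  have norm_e: "(norm e)\<^sup>2 = ?N * (norm m)\<^sup>2 + (norm d)\<^sup>2"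
    unfolding e norm_consensus[symmetric] unfolding dot_square_norm[symmetric]
    using d_orth[of m] by (simp only: inner_add_left inner_add_right inner_commute)
  have Le: "?L *v e = ?L *v d"
    by (simp add: e matrix_vector_right_distrib kron_laplacian_consensus)
  have sym: "transpose ?L = ?L"
    by (simp add: transpose_kron_mat1 transpose_laplacian[OF W(1)])
  have "e \<bullet> (?L *v e) = d \<bullet> (?L *v d)"
    using symmetric_inner_commute[OF sym, of e d] Le
    by (simp add: symmetric_inner_commute[OF sym])
  then have Lap: "?\<sigma> * (norm d)\<^sup>2 \<le> e \<bullet> (?L *v e)"
    using kron_laplacian_rayleigh[OF W card sum_d] by (simp add: dot_square_norm)
  define y where "y = u + m"
  have x: "x - consensus y = d"
    by (simp add: d_def e_def y_def vec_eq_iff)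
  have Re: "?R *v e = m + ?R *v d"
    by (simp add: e matrix_vector_right_distrib sel_mat_consensus)
  let ?g = "?E x - ?F y" and ?k = "?F y - ?F u"
  have g: "norm ?g \<le> \<theta>1 * norm d"
    using lipschitz_onD[OF lip_ext, of x "consensus y"] x
    by (simp add: dist_norm ext_pseudo_gradient_consensus)
  have k: "norm ?k \<le> \<theta> * norm m"
    using lipschitz_onD[OF lip, of y u] by (simp add: dist_norm y_def)
  have Rd: "norm (?R *v d) \<le> norm d"
    by (rule norm_sel_mat_le)
  have "\<mu> * (norm m)\<^sup>2 \<le> m \<bullet> ?k"
    using mono[unfolded strongly_monotone_def, rule_format, of y u]
    by (simp add: y_def inner_commute[of m])
  moreover have "- (norm m * (\<theta>1 * norm d)) \<le> m \<bullet> ?g"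
    using Cauchy_Schwarz_ineq2[of m ?g] mult_left_mono[OF g norm_ge_zero[of m]] by linarith
  moreover have "- (norm d * (\<theta> * norm m)) \<le> (?R *v d) \<bullet> ?k"
    using Cauchy_Schwarz_ineq2[of "?R *v d" ?k] mult_mono[OF Rd k] by simp
  moreover have "- (norm d * (\<theta>1 * norm d)) \<le> (?R *v d) \<bullet> ?g"
    using Cauchy_Schwarz_ineq2[of "?R *v d" ?g] mult_mono[OF Rd g] by simp
  moreover have "(?R *v e) \<bullet> (?E x - ?F u) = m \<bullet> ?k + m \<bullet> ?g + (?R *v d) \<bullet> ?k + (?R *v d) \<bullet> ?g"
    by (simp add: Re inner_add_left inner_diff_right)
  moreover have "c * (?\<sigma> * (norm d)\<^sup>2) \<le> c * (e \<bullet> (?L *v e))"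
    using Lap c by (rule mult_left_mono)
  \<comment> \<open>The two mixed products contribute \<open>\<theta> + \<theta>1\<close>, and the
    product of the selected \<open>d\<close> with \<open>?g\<close> contributes
    \<open>- \<theta>1\<close>.\<close>
  ultimately have bound: "\<mu> * (norm m)\<^sup>2 - (\<theta> + \<theta>1) * (norm m * norm d) + (c * ?\<sigma> - \<theta>1) * (norm d)\<^sup>2
      \<le> (?R *v e) \<bullet> (?E x - ?F u) + c * (e \<bullet> (?L *v e))"
    by (simp add: algebra_simps power2_eq_square)
  \<comment> \<open>A consensus vector is \<open>sqrt ?N\<close> times as long as its profile. This
    scaling therefore gives \<open>v\<close> the length of \<open>e\<close>, and it explains the
    powers of the number of players in \<open>Psi_mat\<close>.\<close>
  define v :: "real^2" where "v = vector [sqrt ?N * norm m, norm d]"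
  have v: "v $ 1 = sqrt ?N * norm m" "v $ 2 = norm d"
    by (simp_all add: v_def)
  have "eig_min ?P * (norm e)\<^sup>2 = eig_min ?P * (v \<bullet> v)"
    by (simp add: norm_e inner_vec_def sum_2 v power2_eq_square[symmetric] power_mult_distrib)
  also have "\<dots> \<le> v \<bullet> (?P *v v)"
    by (rule eig_min_rayleigh[OF transpose_Psi_mat])
  also have "\<dots> = \<mu> * (norm m)\<^sup>2 - (\<theta> + \<theta>1) * (norm m * norm d) + (c * ?\<sigma> - \<theta>1) * (norm d)\<^sup>2"
    using N by (simp add: Psi_mat_quadratic_form v power_mult_distrib)
  finally show ?thesis
    using bound by linarith
qed

section \<open>Lyapunov arguments on the half-line\<close>

text \<open>The derivative at 0 is one-sided; two-sided derivatives are available in the interior,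
  and continuity covers the endpoints.\<close>

lemma nonpos_derivative_antimono:
  fixes f :: "real \<Rightarrow> real"
  assumes "\<And>t. 0 \<le> t \<Longrightarrow> (f has_real_derivative f' t) (at t within {0..})"
    and "\<And>t. 0 \<le> t \<Longrightarrow> f' t \<le> 0" and "0 \<le> s" "s \<le> t"
  shows "f t \<le> f s"
proof (rule DERIV_nonpos_imp_decreasing_open[OF \<open>s \<le> t\<close>])
  fix r assume r: "s < r" "r < t"
  then have "(f has_real_derivative f' r) (at r)"
    using assms(1)[of r] assms(3) at_within_interior[of r "{0..}"] by simp
  then show "\<exists>y. (f has_real_derivative y) (at r) \<and> y \<le> 0"
    using assms(2)[of r] assms(3) r by auto
next
  show "continuous_on {s..t} f"
    using assms(3) by (intro DERIV_continuous_on[where D = f'] has_field_derivative_subset[OF assms(1)]) auto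
qed

lemma antimono_bounded_below_tendsto:
  fixes f :: "real \<Rightarrow> real"
  assumes mono: "\<And>s t. 0 \<le> s \<Longrightarrow> s \<le> t \<Longrightarrow> f t \<le> f s" and bound: "\<And>t. 0 \<le> t \<Longrightarrow> b \<le> f t"
  obtains l where "(f \<longlongrightarrow> l) at_top"
proof -
  let ?l = "INF t\<in>{0..}. f t"
  have bdd: "bdd_below (f ` {0..})"
    using bound by (intro bdd_belowI2[of _ b]) simp
  have "(f \<longlongrightarrow> ?l) at_top"
  proof (rule decreasing_tendsto)
    show "eventually (\<lambda>t. ?l \<le> f t) at_top"
      using eventually_ge_at_top[of 0]
      by eventually_elim (auto intro: cINF_lower[OF bdd])
    fix y assume "?l < y"
    then obtain s where s: "0 \<le> s" "f s < y"
      using cINF_less_iff[OF _ bdd, of y] by auto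
    show "eventually (\<lambda>t. f t < y) at_top"
      using eventually_ge_at_top[of s]
      by eventually_elim (use s mono le_less_trans in blast)
  qed
  then show thesis by (rule that)
qed

text \<open>Both \<open>V\<close> and \<open>f + C / \<delta> * V\<close> decrease, so \<open>f\<close> converges, and a positive limit would drive
  \<open>V\<close> to \<open>-\<infinity>\<close>. This needs no integrability of the decay rate.\<close>

lemma lyapunov_tendsto_0:
  fixes V f g :: "real \<Rightarrow> real"
  assumes V: "\<And>t. 0 \<le> t \<Longrightarrow> (V has_real_derivative V' t) (at t within {0..})"
    and f: "\<And>t. 0 \<le> t \<Longrightarrow> (f has_real_derivative f' t) (at t within {0..})"
    and V': "\<And>t. 0 \<le> t \<Longrightarrow> V' t \<le> - \<delta> * (f t + g t)"
    and f': "\<And>t. 0 \<le> t \<Longrightarrow> f' t \<le> C * (f t + g t)"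
    and nonneg: "\<And>t. 0 \<le> t \<Longrightarrow> 0 \<le> V t" "\<And>t. 0 \<le> t \<Longrightarrow> 0 \<le> f t" "\<And>t. 0 \<le> t \<Longrightarrow> 0 \<le> g t"
    and \<delta>: "0 < \<delta>" and C: "0 \<le> C"
  shows "(f \<longlongrightarrow> 0) at_top"
proof -
  let ?Q = "\<lambda>t. f t + C / \<delta> * V t"
  have V'_le: "V' t \<le> - \<delta> * f t" if "0 \<le> t" for t
  proof -
    have "- \<delta> * (f t + g t) \<le> - \<delta> * f t"
      using nonneg(3)[OF that] \<delta> by simp
    then show ?thesis using V'[OF that] by linarith
  qed
  have V'_nonpos: "V' t \<le> 0" if "0 \<le> t" for t
  proof -
    have "0 \<le> \<delta> * f t"
      using nonneg(2)[OF that] \<delta> by simp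
    then show ?thesis using V'_le[OF that] by linarith
  qed
  have V_mono: "V t \<le> V s" if "0 \<le> s" "s \<le> t" for s t
    using nonpos_derivative_antimono[OF V V'_nonpos that] .
  have Q: "(?Q has_real_derivative f' t + C / \<delta> * V' t) (at t within {0..})" if "0 \<le> t" for t
    by (intro DERIV_add DERIV_cmult f V that)
  have Q': "f' t + C / \<delta> * V' t \<le> 0" if "0 \<le> t" for t
  proof -
    have "C / \<delta> * V' t \<le> C / \<delta> * (- \<delta> * (f t + g t))"
      using V'[OF that] \<delta> C by (intro mult_left_mono) simp_all
    also have "\<dots> = - (C * (f t + g t))"
      using \<delta> by simp
    finally show ?thesis using f'[OF that] by linarith
  qed
  have Q_mono: "?Q t \<le> ?Q s" if "0 \<le> s" "s \<le> t" for s t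
    using nonpos_derivative_antimono[OF Q Q' that] .
  obtain v where v: "(V \<longlongrightarrow> v) at_top"
    using antimono_bounded_below_tendsto[of V 0] V_mono nonneg(1) by metis
  obtain q where q: "(?Q \<longlongrightarrow> q) at_top"
  proof (rule antimono_bounded_below_tendsto[of ?Q 0])
    show "?Q t \<le> ?Q s" if "0 \<le> s" "s \<le> t" for s t
      using Q_mono that .
    show "0 \<le> ?Q t" if "0 \<le> t" for t
      using nonneg[OF that] \<delta> C by simp
  qed
  define a where "a = q - C / \<delta> * v"
  have "((\<lambda>t. ?Q t - C / \<delta> * V t) \<longlongrightarrow> a) at_top"
    unfolding a_def by (intro tendsto_intros q v)
  then have lim: "(f \<longlongrightarrow> a) at_top" by simp
  have "a \<le> 0"
  proof (rule ccontr)
    assume "\<not> a \<le> 0"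
    then have "eventually (\<lambda>t. a / 2 < f t) at_top"
      by (intro order_tendstoD(1)[OF lim]) simp
    then obtain s0 where s0: "\<And>t. s0 \<le> t \<Longrightarrow> a / 2 < f t"
      by (auto simp: eventually_at_top_linorder)
    define s where "s = max 0 s0"
    define k where "k = \<delta> * (a / 2)"
    have k: "0 < k" using \<delta> \<open>\<not> a \<le> 0\<close> by (simp add: k_def)
    \<comment> \<open>The term \<open>k * r\<close> compensates the linear loss of \<open>V\<close>,
      so that the loss reads as monotonicity of \<open>U\<close>. The shift by \<open>s\<close>
      moves the late times to the half-line starting at 0.\<close>
    define U where "U r = V (r + s) + k * r" for r
    have shift: "((\<lambda>r. V (r + s)) has_real_derivative V' (r + s)) (at r within {0..})"
      if "0 \<le> r" for r
    proof -
      have "(V has_real_derivative V' (r + s)) (at (r + s) within (\<lambda>r. r + s) ` {0..})"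
        using V[of "r + s"] that by (auto simp: s_def intro: has_field_derivative_subset)
      moreover have "((\<lambda>r. r + s) has_real_derivative 1) (at r within {0..})"
        by (auto intro!: derivative_eq_intros)
      ultimately show ?thesis
        using DERIV_image_chain[of V "V' (r + s)" "\<lambda>r. r + s" r "{0..}" 1]
        by (simp add: o_def)
    qed
    have U': "(U has_real_derivative V' (r + s) + k) (at r within {0..})" if "0 \<le> r" for r
      unfolding U_def using shift[OF that] by (auto intro!: derivative_eq_intros)
    have "V' (r + s) + k \<le> 0" if "0 \<le> r" for r
    proof -
      have r: "0 \<le> r + s" "s0 \<le> r + s" using that by (auto simp: s_def)
      have "k \<le> \<delta> * f (r + s)"
        unfolding k_def using s0[OF r(2)] \<delta> by (intro mult_left_mono) simp_all
      then show ?thesis using V'_le[OF r(1)] by linarith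
    qed
    from nonpos_derivative_antimono[OF U' this order_refl]
    have decay: "U r \<le> U 0" if "0 \<le> r" for r
      using that by blast
    \<comment> \<open>By this time the loss amounts to \<open>V s + 1\<close>, more than
      \<open>V s\<close> can afford.\<close>
    define r where "r = (V s + 1) / k"
    have s: "0 \<le> s" by (simp add: s_def)
    have "0 \<le> r"
      using k nonneg(1)[OF s] by (simp add: r_def)
    then have "V (r + s) + (V s + 1) \<le> V s"
      using decay[of r] k by (simp add: U_def r_def)
    then show False
      using nonneg(1)[of "r + s"] s \<open>0 \<le> r\<close> by linarith
  qed
  moreover have "0 \<le> a"
    by (rule tendsto_lowerbound[OF lim])
      (auto intro: eventually_mono[OF eventually_ge_at_top[of 0]] nonneg)
  ultimately show ?thesis
    using lim by simp
qed

text \<open>The integrating factor \<open>exp (\<alpha> * t)\<close> turns the differential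
  inequality into monotonicity.\<close>

lemma linear_decay_nonpos:
  fixes y :: "real \<Rightarrow> real"
  assumes y: "\<And>t. 0 \<le> t \<Longrightarrow> (y has_real_derivative y' t) (at t within {0..})"
    and y': "\<And>t. 0 \<le> t \<Longrightarrow> y' t \<le> - \<alpha> * y t" and "y 0 \<le> 0" "0 \<le> t"
  shows "y t \<le> 0"
proof -
  have "exp (\<alpha> * t) * y t \<le> exp (\<alpha> * 0) * y 0"
  proof (rule nonpos_derivative_antimono[where f = "\<lambda>t. exp (\<alpha> * t) * y t"
        and f' = "\<lambda>s. exp (\<alpha> * s) * (y' s + \<alpha> * y s)"])
    fix s :: real assume s: "0 \<le> s"
    show "((\<lambda>t. exp (\<alpha> * t) * y t) has_real_derivative exp (\<alpha> * s) * (y' s + \<alpha> * y s))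
        (at s within {0..})"
      using y[OF s] by (auto intro!: derivative_eq_intros simp: algebra_simps)
    show "exp (\<alpha> * s) * (y' s + \<alpha> * y s) \<le> 0"
      using y'[OF s] by (simp add: mult_le_0_iff)
  qed (use assms in auto)
  also have "\<dots> \<le> 0" using assms by simp
  finally show ?thesis by (simp add: mult_le_0_iff)
qed

lemma quadratic_form_2_coercive:
  fixes b \<kappa> :: real
  assumes "\<kappa>\<^sup>2 / 4 < b"
  obtains \<delta> where "0 < \<delta>" "\<And>x y. \<delta> * (x\<^sup>2 + y\<^sup>2) \<le> b * x\<^sup>2 - \<kappa> * (x * y) + y\<^sup>2"
proof -
  have b: "0 < b"
    using assms zero_le_power2[of \<kappa>] by linarith
  \<comment> \<open>This choice gives \<open>(b - \<delta>) * (1 - \<delta>) = \<kappa>\<^sup>2 / 4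
    + \<delta>\<^sup>2\<close>, so the form stays nonnegative after \<open>\<delta>\<close> is
    subtracted on the diagonal.\<close>
  define \<delta> where "\<delta> = (b - \<kappa>\<^sup>2 / 4) / (1 + b)"
  have \<delta>: "0 < \<delta>" "\<delta> < 1"
  proof -
    have "0 < b - \<kappa>\<^sup>2 / 4" "b - \<kappa>\<^sup>2 / 4 < 1 + b"
      using assms zero_le_power2[of \<kappa>] by linarith+
    then show "0 < \<delta>" "\<delta> < 1"
      unfolding \<delta>_def using b by (auto simp only: divide_less_eq_1_pos intro!: divide_pos_pos)
  qed
  have "\<delta> * (1 + b) = b - \<kappa>\<^sup>2 / 4"
    using b by (simp add: \<delta>_def)
  then have prod: "\<kappa>\<^sup>2 / 4 \<le> (b - \<delta>) * (1 - \<delta>)"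
    using zero_le_square[of \<delta>] by (simp add: algebra_simps)
  have "\<delta> * (x\<^sup>2 + y\<^sup>2) \<le> b * x\<^sup>2 - \<kappa> * (x * y) + y\<^sup>2" for x y
  proof -
    have "(1 - \<delta>) * (b * x\<^sup>2 - \<kappa> * (x * y) + y\<^sup>2 - \<delta> * (x\<^sup>2 + y\<^sup>2)) =
        ((1 - \<delta>) * y - \<kappa> / 2 * x)\<^sup>2 + ((b - \<delta>) * (1 - \<delta>) - \<kappa>\<^sup>2 / 4) * x\<^sup>2"
      by (simp add: power2_eq_square algebra_simps)
    also have "0 \<le> \<dots>"
      using prod by simp
    finally show ?thesis
      using \<delta> by (simp add: zero_le_mult_iff)
  qed
  then show thesis
    using \<delta>(1) that by blast
qed

section \<open>The quadratic program\<close>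

text \<open>Moving from \<open>l\<close> a fraction \<open>s\<close> of the way to \<open>y\<close>
  changes the cost by \<open>s * (a + s * K / 2)\<close>; a negative slope \<open>a\<close> would
  contradict minimality for small \<open>s\<close>.\<close>

lemma is_arg_min_quadratic:
  fixes Q :: "real^'n^'n"
  assumes sym: "transpose Q = Q" and psd: "\<And>v. 0 \<le> v \<bullet> (Q *v v)"
    and min: "is_arg_min (\<lambda>v. 1 / 2 * (v \<bullet> (Q *v v)) + v \<bullet> b) P l"
    and P: "\<And>s. 0 < s \<Longrightarrow> s \<le> 1 \<Longrightarrow> P (l + s *\<^sub>R (y - l))"
  shows "0 \<le> (y - l) \<bullet> (Q *v l + b)"
proof (rule ccontr)
  define d where "d = y - l"
  define K where "K = d \<bullet> (Q *v d)"
  define a where "a = d \<bullet> (Q *v l + b)"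
  have step: "0 \<le> s * (a + s * K / 2)" if "0 < s" "s \<le> 1" for s
  proof -
    have "1 / 2 * (l \<bullet> (Q *v l)) + l \<bullet> b \<le>
        1 / 2 * ((l + s *\<^sub>R d) \<bullet> (Q *v (l + s *\<^sub>R d))) + (l + s *\<^sub>R d) \<bullet> b"
      using min P[OF that] by (simp add: is_arg_min_linorder d_def)
    also have "(l + s *\<^sub>R d) \<bullet> (Q *v (l + s *\<^sub>R d)) =
        l \<bullet> (Q *v l) + 2 * s * (d \<bullet> (Q *v l)) + s * (s * K)"
    proof -
      have "l \<bullet> (Q *v d) = d \<bullet> (Q *v l)"
        using symmetric_inner_commute[OF sym, of l d] by (simp only: inner_commute)
      then show ?thesis
        by (simp add: K_def matrix_vector_right_distrib matrix_vector_mult_scaleR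
            inner_add_left inner_add_right distrib_left)
    qed
    also have "1 / 2 * (l \<bullet> (Q *v l) + 2 * s * (d \<bullet> (Q *v l)) + s * (s * K)) + (l + s *\<^sub>R d) \<bullet> b
        = 1 / 2 * (l \<bullet> (Q *v l)) + l \<bullet> b + s * (a + s * K / 2)"
      by (simp add: a_def inner_add_left inner_add_right distrib_left)
    finally show ?thesis by simp
  qed
  assume "\<not> 0 \<le> (y - l) \<bullet> (Q *v l + b)"
  then have a: "a < 0" by (simp add: a_def d_def)
  have K: "0 \<le> K" unfolding K_def by (rule psd)
  \<comment> \<open>It ensures \<open>s * K \<le> - a\<close>, so the quadratic term cancels at most
    half of the slope.\<close>
  define s where "s = min 1 (- a / (K + 1))"
  have s: "0 < s" "s \<le> 1"
    using a K divide_pos_pos[of "- a" "K + 1"] by (simp_all add: s_def)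
  have "s * K \<le> - a / (K + 1) * K"
    using K by (intro mult_right_mono) (simp_all add: s_def)
  also have "\<dots> \<le> - a"
    using a K by (simp add: field_simps)
  finally have "a + s * K / 2 < 0"
    using a by simp
  then show False
    using step[OF s] s(1) by (simp add: zero_le_mult_iff)
qed

text \<open>The drift is \<open>- R x'\<close>, and the residual is the gradient of the quadratic program at its
  solution \<open>l\<close>, that is, the slack of its KKT conditions.\<close>

definition drift where
  "drift own J G W c x l = ext_pseudo_gradient own J x + l v* diag_blocks own G
     + c *\<^sub>R (sel_mat own *v (kron (laplacian W) (mat 1) *v x))"

definition qp_residual where
  "qp_residual own J G h W c \<alpha> x z l = diag_blocks own G *v drift own J G W c x l
     - \<alpha> *\<^sub>R (diag_blocks own G *v (sel_mat own *v x) - stack h)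
     + kron (laplacian W) (mat 1) *v (z + l)"

text \<open>Each coordinate has exactly one owner, so the sum over the players undoes the splitting
  into blocks.\<close>

lemma sum_diag_blocks:
  fixes own :: "'k::finite \<Rightarrow> 'i::finite"
  shows "(\<Sum>i\<in>UNIV. (diag_blocks own G *v u) $ (i, r)) = (G *v u) $ r"
proof -
  have "(\<Sum>i\<in>UNIV. (diag_blocks own G *v u) $ (i, r)) =
      (\<Sum>k\<in>UNIV. \<Sum>i\<in>UNIV. (if own k = i then G $ r $ k else 0) * u $ k)"
    by (simp only: diag_blocks_def matrix_vector_mult_def vec_lambda_beta fst_conv snd_conv)
      (rule sum.swap)
  also have "\<dots> = (\<Sum>k\<in>UNIV. G $ r $ k * u $ k)"
    by (simp flip: sum_distrib_right)
  finally show ?thesis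
    by (simp add: matrix_vector_mult_def)
qed

text \<open>Copying a vector to all players is adjoint to summing over them, which makes this the
  dual of \<open>sum_diag_blocks\<close>.\<close>

lemma consensus_diag_blocks:
  fixes own :: "'k::finite \<Rightarrow> 'i::finite"
  shows "consensus l v* diag_blocks own G = transpose G *v l"
proof (rule vector_eq_ldot[THEN iffD1], rule allI)
  fix u
  have "u \<bullet> (consensus l v* diag_blocks own G) = consensus l \<bullet> (diag_blocks own G *v u)"
    by (subst inner_commute) (rule dot_lmul_matrix)
  also have "\<dots> = (G *v u) \<bullet> l"
    unfolding inner_commute[of "consensus l"] inner_consensus sum_diag_blocks
    by (simp add: inner_vec_def)
  also have "\<dots> = u \<bullet> (transpose G *v l)"
    by (simp only: inner_matrix_vector transpose_transpose)
  finally show "u \<bullet> (consensus l v* diag_blocks own G) = u \<bullet> (transpose G *v l)" .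
qed

text \<open>This is the first-order condition for a convex cost, whose Hessian \<open>?Q\<close> is
  a Gram matrix plus a Laplacian. The Gram part applied to \<open>l\<close> is absorbed into
  \<open>drift\<close>, and the Laplacian part into \<open>z + l\<close>.\<close>

lemma qp_residual_VI:
  fixes own :: "'k::finite \<Rightarrow> 'i::finite" and G :: "real^'k^'m::finite" and W :: "real^'i^'i"
  assumes W: "weighted_graph W"
    and min: "is_arg_min (qp_cost own J G h W c \<alpha> x z) (\<lambda>v. 0 \<le> v) l" and y: "0 \<le> y"
  shows "0 \<le> (y - l) \<bullet> qp_residual own J G h W c \<alpha> x z l"
proof -
  let ?Gd = "diag_blocks own G" and ?R = "sel_mat own"
    and ?Lm = "kron (laplacian W) (mat 1 :: real^'m^'m)" and ?Ln = "kron (laplacian W) (mat 1 :: real^'k^'k)"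
  let ?Q = "?Gd ** transpose ?Gd + ?Lm"
  define b where "b = ?Gd *v ext_pseudo_gradient own J x + c *\<^sub>R ((?Gd ** ?R ** ?Ln) *v x)
                - \<alpha> *\<^sub>R ((?Gd ** ?R) *v x - stack h) + ?Lm *v z"
  have Q: "?Q *v v = ?Gd *v (v v* ?Gd) + ?Lm *v v" for v
    by (simp add: matrix_vector_mult_add_rdistrib flip: matrix_vector_mul_assoc)
  have GG: "v \<bullet> (?Gd *v (v v* ?Gd)) = (norm (transpose ?Gd *v v))\<^sup>2" for v
    by (simp add: dot_lmul_matrix[symmetric] dot_square_norm)
  have "transpose (?Gd ** transpose ?Gd) = ?Gd ** transpose ?Gd"
    by (simp add: matrix_transpose_mul)
  moreover have "transpose ?Lm = ?Lm"
    by (simp add: transpose_kron_mat1 transpose_laplacian[OF W])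
  ultimately have sym: "transpose ?Q = ?Q"
    by (simp add: transpose_def vec_eq_iff)
  have psd: "0 \<le> v \<bullet> (?Q *v v)" for v
    unfolding Q inner_add_right GG
    by (intro add_nonneg_nonneg zero_le_power2 kron_laplacian_psd[OF W])
  have cost: "qp_cost own J G h W c \<alpha> x z = (\<lambda>v. 1 / 2 * (v \<bullet> (?Q *v v)) + v \<bullet> b)"
    unfolding fun_eq_iff Q inner_add_right GG
    by (simp add: qp_cost_def Let_def b_def inner_add_right algebra_simps)
  have l: "0 \<le> l"
    using min by (simp add: is_arg_min_def)
  have "0 \<le> (y - l) \<bullet> (?Q *v l + b)"
  proof (rule is_arg_min_quadratic[OF sym psd min[unfolded cost]])
    fix s :: real assume s: "0 < s" "s \<le> 1"
    have "l + s *\<^sub>R (y - l) = (1 - s) *\<^sub>R l + s *\<^sub>R y"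
      by (simp add: algebra_simps)
    then show "0 \<le> l + s *\<^sub>R (y - l)"
      using l y s by (simp add: less_eq_vec_def)
  qed
  also have "?Q *v l + b = qp_residual own J G h W c \<alpha> x z l"
    unfolding Q
    by (simp add: b_def qp_residual_def drift_def matrix_vector_right_distrib
        matrix_vector_mult_scaleR matrix_vector_mul_assoc[symmetric])
  finally show ?thesis .
qed

text \<open>Raising a single multiplier by one stays admissible, so the inequality reads off one
  entry of the residual.\<close>

lemma qp_residual_nonneg:
  fixes own :: "'k::finite \<Rightarrow> 'i::finite" and G :: "real^'k^'m::finite" and W :: "real^'i^'i"
  assumes W: "weighted_graph W"
    and min: "is_arg_min (qp_cost own J G h W c \<alpha> x z) (\<lambda>v. 0 \<le> v) l"
  shows "0 \<le> qp_residual own J G h W c \<alpha> x z l $ p"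
proof -
  have "0 \<le> l"
    using min by (simp add: is_arg_min_def)
  then have "0 \<le> l + axis p 1"
    by (simp add: less_eq_vec_def axis_def)
  from qp_residual_VI[OF W min this] show ?thesis
    by (simp add: inner_axis')
qed

text \<open>The Laplacian terms sum to zero and the blocks recombine to \<open>G\<close>. What
  remains couples each global constraint with its rate of change, without any multiplier
  exchange.\<close>

lemma sum_qp_residual:
  fixes own :: "'k::finite \<Rightarrow> 'i::finite" and G :: "real^'k^'m::finite" and W :: "real^'i^'i"
  assumes W: "weighted_graph W"
  shows "(\<Sum>i\<in>UNIV. qp_residual own J G h W c \<alpha> x z l $ (i, r)) =
    (G *v drift own J G W c x l) $ r - \<alpha> * ((G *v (sel_mat own *v x)) $ r - (\<Sum>i\<in>UNIV. h i) $ r)"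
proof -
  have "(\<Sum>i\<in>UNIV. stack h $ (i, r)) = (\<Sum>i\<in>UNIV. h i) $ r"
    by (simp add: stack_def)
  then show ?thesis
    unfolding qp_residual_def
    by (simp add: sum.distrib sum_subtractf sum_diag_blocks sum_kron_laplacian[OF W]
        flip: sum_distrib_left)
qed

section \<open>Trajectories\<close>

lemma trajectoryD:
  fixes own :: "'k::finite \<Rightarrow> 'i::finite" and G :: "real^'k^'m::finite" and W :: "real^'i^'i"
  assumes "trajectory own J G h W c \<alpha> x z l" "0 \<le> t"
  shows "(x has_vector_derivative
      - ((ext_pseudo_gradient own J (x t) + l t v* diag_blocks own G) v* sel_mat own)
      - c *\<^sub>R (kron (laplacian W) (mat 1) *v x t)) (at t within {0..})"
    and "(z has_vector_derivative kron (laplacian W) (mat 1) *v l t) (at t within {0..})"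
    and "is_arg_min (qp_cost own J G h W c \<alpha> (x t) (z t)) (\<lambda>v. 0 \<le> v) (l t)"
proof -
  have eq: "- (transpose (sel_mat own) *v ext_pseudo_gradient own J (x t))
            - (transpose (sel_mat own) ** transpose (diag_blocks own G)) *v l t
      = - ((ext_pseudo_gradient own J (x t) + l t v* diag_blocks own G) v* sel_mat own)"
    unfolding matrix_vector_mul_assoc[symmetric] transpose_matrix_vector
    by (simp add: transpose_matrix_vector[symmetric] matrix_vector_right_distrib
        del: transpose_matrix_vector)
  note D = assms(1)[unfolded trajectory_def Let_def, rule_format, OF assms(2)]
  show "(x has_vector_derivative
      - ((ext_pseudo_gradient own J (x t) + l t v* diag_blocks own G) v* sel_mat own)
      - c *\<^sub>R (kron (laplacian W) (mat 1) *v x t)) (at t within {0..})"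
    using conjunct1[OF D] unfolding eq .
  show "(z has_vector_derivative kron (laplacian W) (mat 1) *v l t) (at t within {0..})"
    "is_arg_min (qp_cost own J G h W c \<alpha> (x t) (z t)) (\<lambda>v. 0 \<le> v) (l t)"
    by (rule conjunct1[OF conjunct2[OF D]], rule conjunct2[OF conjunct2[OF D]])
qed

lemma trajectory_decision_derivative:
  assumes "trajectory own J G h W c \<alpha> x z l" "0 \<le> t"
  shows "((\<lambda>t. sel_mat own *v x t) has_vector_derivative - drift own J G W c (x t) (l t))
    (at t within {0..})"
proof -
  have eq: "sel_mat own *v (- (a v* sel_mat own) - b) = - (a + sel_mat own *v b)" for a b
    using matrix_vector_mult_scaleR[of "sel_mat own" "-1" "a v* sel_mat own"]
    by (simp add: matrix_vector_mult_diff_distrib sel_mat_transpose)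
  show ?thesis
    using bounded_linear.has_vector_derivative[OF matrix_vector_mul_bounded_linear trajectoryD(1)[OF assms],
        of "sel_mat own"]
    by (simp add: eq drift_def matrix_vector_mult_scaleR)
qed

lemma trajectory_feasible:
  fixes own :: "'k::finite \<Rightarrow> 'i::finite" and G :: "real^'k^'m::finite" and W :: "real^'i^'i"
  assumes W: "weighted_graph W" and traj: "trajectory own J G h W c \<alpha> x z l"
    and init: "sel_mat own *v x 0 \<in> feasible_set G h" and t: "0 \<le> t"
  shows "sel_mat own *v x t \<in> feasible_set G h"
  unfolding mem_feasible_set
proof
  fix r
  let ?H = "(\<Sum>i\<in>UNIV. h i) $ r"
  let ?y = "\<lambda>t. (G *v (sel_mat own *v x t)) $ r - ?H"
  have "?y t \<le> 0"
  proof (rule linear_decay_nonpos[OF _ _ _ t])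
    fix s :: real assume s: "0 \<le> s"
    have bl: "bounded_linear (\<lambda>u. (G *v u) $ r)"
      by (intro bounded_linear_compose[OF bounded_linear_vec_nth] matrix_vector_mul_bounded_linear)
    show "(?y has_real_derivative (G *v (- drift own J G W c (x s) (l s))) $ r) (at s within {0..})"
      using bounded_linear.has_vector_derivative[OF bl trajectory_decision_derivative[OF traj s]]
      by (auto simp: has_real_derivative_iff_has_vector_derivative intro!: derivative_eq_intros)
    have "0 \<le> (\<Sum>i\<in>UNIV. qp_residual own J G h W c \<alpha> (x s) (z s) (l s) $ (i, r))"
      by (intro sum_nonneg qp_residual_nonneg[OF W trajectoryD(3)[OF traj s]])
    then show "(G *v (- drift own J G W c (x s) (l s))) $ r \<le> - \<alpha> * ?y s"
      unfolding sum_qp_residual[OF W]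
      using matrix_vector_mult_scaleR[of G "-1" "drift own J G W c (x s) (l s)"] by simp
  next
    show "?y 0 \<le> 0"
      using init by (simp add: mem_feasible_set)
  qed
  then show "(G *v (sel_mat own *v x t)) $ r \<le> ?H" by simp
qed

lemma trajectory_converges:
  fixes own :: "'k::finite \<Rightarrow> 'i::finite" and G :: "real^'k^'m::finite" and W :: "real^'i^'i"
    and h :: "'i \<Rightarrow> real^'m"
  assumes card: "2 \<le> CARD('i)"
    and mono: "strongly_monotone \<mu> (pseudo_gradient own J)"
    and lip: "\<theta>-lipschitz_on UNIV (pseudo_gradient own J)"
    and lip_ext: "\<theta>1-lipschitz_on UNIV (ext_pseudo_gradient own J)"
    and W: "weighted_graph W" "connected_graph W" and c: "0 \<le> c" and \<alpha>: "0 < \<alpha>"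
    and \<mu>bar: "\<mu>bar = eig_min (Psi_mat \<mu> \<theta> \<theta>1 c (eig_second (laplacian W)) CARD('i))" "0 < \<mu>bar"
    and \<alpha>_gt: "(\<theta>1 + c * eig_max (laplacian W))\<^sup>2 / (4 * \<mu>bar) < \<alpha>"
    and u_feas: "u \<in> feasible_set G h"
    and kkt: "pseudo_gradient own J u + transpose G *v m = 0" "0 \<le> m"
      "m \<bullet> ((\<Sum>i\<in>UNIV. h i) - G *v u) = 0"
    and traj: "trajectory own J G h W c \<alpha> x z l"
  shows "((\<lambda>t. sel_mat own *v x t) \<longlongrightarrow> u) at_top"
proof -
  let ?H = "\<Sum>i\<in>UNIV. h i" and ?Gd = "diag_blocks own G" and ?R = "sel_mat own"
    and ?Lm = "kron (laplacian W) (mat 1) :: real^('i \<times> 'm)^('i \<times> 'm)"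
    and ?Ln = "kron (laplacian W) (mat 1) :: real^('i \<times> 'k)^('i \<times> 'k)"
  let ?E = "ext_pseudo_gradient own J" and ?F = "pseudo_gradient own J"
  let ?N = "real CARD('i)"
  define \<kappa> where "\<kappa> = \<theta>1 + c * eig_max (laplacian W)"
  have \<theta>1: "0 \<le> \<theta>1" using lip_ext by (rule lipschitz_on_nonneg)
  have Lm_sym: "transpose ?Lm = ?Lm"
    by (simp add: transpose_kron_mat1 transpose_laplacian[OF W(1)])

  \<comment> \<open>At \<open>u\<close> the constraint data of a single player need not balance;
    only the sum is feasible. Equal shares of the total slack leave imbalances of zero sum, which
    lie in the range of the Laplacian.\<close>
  define slack :: "real^'m" where "slack = (\<alpha> / ?N) *\<^sub>R (?H - G *v u)"
  have slack_nonneg: "0 \<le> slack $ r" for r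
    using u_feas \<alpha> by (simp add: slack_def mem_feasible_set)
  have "(\<Sum>i\<in>UNIV. (\<alpha> *\<^sub>R (?Gd *v u - stack h) + consensus slack) $ (i, r)) = 0" for r
  proof -
    have "(\<Sum>i\<in>UNIV. (\<alpha> *\<^sub>R (?Gd *v u - stack h) + consensus slack) $ (i, r)) =
        \<alpha> * ((\<Sum>i\<in>UNIV. (?Gd *v u) $ (i, r)) - (\<Sum>i\<in>UNIV. stack h $ (i, r))) + ?N * slack $ r"
      by (simp add: sum.distrib sum_subtractf flip: sum_distrib_left)
    also have "\<dots> = 0"
      by (simp add: sum_diag_blocks stack_def slack_def algebra_simps)
    finally show ?thesis .
  qed
  \<comment> \<open>At \<open>consensus u\<close>, \<open>zs\<close> and \<open>consensus m\<close>
    the residual is then \<open>consensus slack\<close>, which is nonnegative and complementary to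
    \<open>consensus m\<close>.\<close>
  then obtain zs where zs: "?Lm *v zs = \<alpha> *\<^sub>R (?Gd *v u - stack h) + consensus slack"
    using range_kron_laplacian[OF W] by blast

  define e where "e t = x t - consensus u" for t
  define p where "p t = (l t - consensus m) v* ?Gd" for t
  define D where "D t = ?E (x t) - ?F u" for t
  have e_D: "norm (D t) \<le> \<theta>1 * norm (e t)" for t
    using lipschitz_onD[OF lip_ext, of "x t" "consensus u"]
    by (simp add: dist_norm ext_pseudo_gradient_consensus D_def e_def)
  have Ln_e: "?Ln *v x t = ?Ln *v e t" for t
    by (simp add: e_def matrix_vector_mult_diff_distrib kron_laplacian_consensus)
  \<comment> \<open>Stationarity of \<open>u\<close> makes the equilibrium values of the two terms
    cancel.\<close>
  have FG: "?E (x t) + l t v* ?Gd = D t + p t" for t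
  proof -
    have "p t = l t v* ?Gd - consensus m v* ?Gd"
      by (simp add: p_def transpose_matrix_vector[symmetric] matrix_vector_mult_diff_distrib
          del: transpose_matrix_vector)
    moreover have "consensus m v* ?Gd = - ?F u"
      using kkt(1) by (simp add: consensus_diag_blocks eq_neg_iff_add_eq_0 add.commute)
    ultimately show ?thesis
      by (simp add: D_def)
  qed
  have drift: "drift own J G W c (x t) (l t) = D t + p t + c *\<^sub>R (?R *v (?Ln *v e t))" for t
    by (simp add: drift_def FG Ln_e)
  \<comment> \<open>This is the origin of \<open>\<kappa>\<close>: it bounds the drift apart from
    \<open>p\<close> by the error.\<close>
  have coupling: "norm (D t + c *\<^sub>R (?R *v (?Ln *v e t))) \<le> \<kappa> * norm (e t)" for t
  proof -
    have "norm (?R *v (?Ln *v e t)) \<le> eig_max (laplacian W) * norm (e t)"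
      using norm_sel_mat_le norm_kron_laplacian_le[OF W(1)] order_trans by blast
    then have "c * norm (?R *v (?Ln *v e t)) \<le> c * (eig_max (laplacian W) * norm (e t))"
      using c by (rule mult_left_mono)
    then show ?thesis
      using norm_triangle_ineq[of "D t" "c *\<^sub>R (?R *v (?Ln *v e t))"] e_D[of t] c
      by (simp add: \<kappa>_def algebra_simps)
  qed

  define x' where "x' t = - ((D t + p t) v* ?R) - c *\<^sub>R (?Ln *v e t)" for t
  have e_deriv: "(e has_vector_derivative x' t) (at t within {0..})" if "0 \<le> t" for t
    using trajectoryD(1)[OF traj that] unfolding e_def[abs_def] x'_def FG Ln_e
    by (auto intro!: derivative_eq_intros)
  have e_x': "e t \<bullet> x' t = - ((?R *v e t) \<bullet> D t + c * (e t \<bullet> (?Ln *v e t))) - (?R *v e t) \<bullet> p t" for t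
    by (simp add: x'_def inner_diff_right inner_transpose_sel_mat inner_add_right)
  define f where "f t = (norm (e t))\<^sup>2" for t
  define g where "g t = (norm (p t))\<^sup>2" for t
  \<comment> \<open>The weight \<open>\<alpha>\<close> is chosen so that the product of
    \<open>?R *v e t\<close> with \<open>p t\<close> cancels against the one in the
    residual.\<close>
  define V where "V t = \<alpha> / 2 * f t + 1 / 2 * ((z t - zs) \<bullet> (z t - zs))" for t
  have f_deriv: "(f has_real_derivative 2 * (e t \<bullet> x' t)) (at t within {0..})" if "0 \<le> t" for t
    using bounded_bilinear.has_vector_derivative[OF bounded_bilinear_inner e_deriv[OF that] e_deriv[OF that]]
    by (simp add: f_def[abs_def] has_real_derivative_iff_has_vector_derivative
        dot_square_norm[symmetric] inner_commute)
  have V_deriv: "(V has_real_derivative \<alpha> * (e t \<bullet> x' t) + (z t - zs) \<bullet> (?Lm *v l t)) (at t within {0..})"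
    if "0 \<le> t" for t
  proof -
    have zd: "((\<lambda>t. z t - zs) has_vector_derivative ?Lm *v l t) (at t within {0..})"
      using trajectoryD(2)[OF traj that] by (auto intro!: derivative_eq_intros)
    have "((\<lambda>t. (z t - zs) \<bullet> (z t - zs)) has_real_derivative 2 * ((z t - zs) \<bullet> (?Lm *v l t)))
        (at t within {0..})"
      using bounded_bilinear.has_vector_derivative[OF bounded_bilinear_inner zd zd]
      by (simp add: has_real_derivative_iff_has_vector_derivative inner_commute)
    then show ?thesis
      unfolding V_def[abs_def] using f_deriv[OF that] by (auto intro!: derivative_eq_intros)
  qed

  have V_bound: "\<alpha> * (e t \<bullet> x' t) + (z t - zs) \<bullet> (?Lm *v l t)
      \<le> - (\<alpha> * \<mu>bar * f t - \<kappa> * (norm (e t) * norm (p t)) + g t)" if t: "0 \<le> t" for t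
  proof -
    let ?w = "qp_residual own J G h W c \<alpha> (x t) (z t) (l t)" and ?d = "l t - consensus m"
    note min = trajectoryD(3)[OF traj t]
    have l: "0 \<le> l t"
      using min by (simp add: is_arg_min_def)
    have "0 \<le> (consensus m - l t) \<bullet> ?w"
      using kkt(2) by (intro qp_residual_VI[OF W(1) min]) (simp add: less_eq_vec_def)
    then have 1: "?d \<bullet> ?w \<le> 0"
      by (simp add: inner_diff_left)
    \<comment> \<open>Complementarity removes \<open>m\<close> from the pairing with the slack and
      leaves the nonnegative \<open>l t\<close>.\<close>
    have "consensus m \<bullet> (consensus slack :: real^('i \<times> 'm)) = ?N * (m \<bullet> slack)"
      by (simp add: inner_consensus) (simp add: inner_vec_def sum_distrib_left mult.assoc)
    also have "\<dots> = 0"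
      using kkt(3) by (simp add: slack_def)
    finally have "?d \<bullet> consensus slack = l t \<bullet> consensus slack"
      by (simp add: inner_diff_left)
    also have "0 \<le> \<dots>"
      unfolding inner_vec_def
      by (intro sum_nonneg) (use l slack_nonneg in \<open>simp add: less_eq_vec_def split_paired_all\<close>)
    finally have 2: "0 \<le> ?d \<bullet> consensus slack" .
    have Lm_l: "?Lm *v l t = ?Lm *v ?d"
      by (simp add: matrix_vector_mult_diff_distrib kron_laplacian_consensus)
    have w: "?w = ?Gd *v drift own J G W c (x t) (l t) - \<alpha> *\<^sub>R (?Gd *v (?R *v e t))
        + ?Lm *v (z t - zs) + ?Lm *v ?d + consensus slack"
    proof -
      have "?R *v x t = ?R *v e t + u"
        by (simp add: e_def matrix_vector_mult_diff_distrib sel_mat_consensus)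
      then show ?thesis
        unfolding qp_residual_def Lm_l[symmetric]
        using zs by (simp add: matrix_vector_right_distrib matrix_vector_mult_diff_distrib algebra_simps)
    qed
    have Gd: "?d \<bullet> (?Gd *v v) = p t \<bullet> v" for v
      by (simp add: p_def dot_lmul_matrix)
    have "0 \<le> ?d \<bullet> (?Lm *v ?d)"
      by (rule kron_laplacian_psd[OF W(1)])
    moreover have "?d \<bullet> (?Lm *v (z t - zs)) = (z t - zs) \<bullet> (?Lm *v l t)"
      unfolding Lm_l using symmetric_inner_commute[OF Lm_sym] by (simp add: inner_commute)
    \<comment> \<open>Expanding \<open>w\<close> in \<open>1\<close>, the slack pairing and the
      Laplacian energy have a favourable sign and are dropped.\<close>
    ultimately have 3: "(z t - zs) \<bullet> (?Lm *v l t) - \<alpha> * (p t \<bullet> (?R *v e t))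
        \<le> - (p t \<bullet> drift own J G W c (x t) (l t))"
      using 1 2 unfolding w by (simp add: inner_add_right inner_diff_right Gd)
    have "- (p t \<bullet> drift own J G W c (x t) (l t)) = - (p t \<bullet> (D t + c *\<^sub>R (?R *v (?Ln *v e t)))) - g t"
      by (simp add: drift inner_add_right g_def dot_square_norm)
    moreover have "- (p t \<bullet> (D t + c *\<^sub>R (?R *v (?Ln *v e t)))) \<le> norm (p t) * (\<kappa> * norm (e t))"
      using Cauchy_Schwarz_ineq2[of "p t" "D t + c *\<^sub>R (?R *v (?Ln *v e t))"]
        mult_left_mono[OF coupling[of t] norm_ge_zero[of "p t"]] by linarith
    moreover have "\<alpha> * (\<mu>bar * f t) \<le> \<alpha> * ((?R *v e t) \<bullet> D t + c * (e t \<bullet> (?Ln *v e t)))"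
      using ext_pseudo_gradient_restricted_monotone[OF card mono lip lip_ext W c, of "x t" u] \<alpha>
      by (intro mult_left_mono) (simp_all add: \<mu>bar(1) f_def e_def D_def)
    ultimately show ?thesis
      using 3 unfolding e_x' by (simp add: algebra_simps inner_commute)
  qed

  \<comment> \<open>The lower bound on \<open>\<alpha>\<close> becomes the discriminant condition
    for the form in \<open>norm (e t)\<close> and \<open>norm (p t)\<close>.\<close>
  have "\<kappa>\<^sup>2 / 4 < \<alpha> * \<mu>bar"
    using \<alpha>_gt \<mu>bar(2) by (simp add: \<kappa>_def field_simps)
  then obtain \<delta> where \<delta>: "0 < \<delta>"
    "\<And>a b. \<delta> * (a\<^sup>2 + b\<^sup>2) \<le> \<alpha> * \<mu>bar * a\<^sup>2 - \<kappa> * (a * b) + b\<^sup>2"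
    using quadratic_form_2_coercive by blast
  have "(f \<longlongrightarrow> 0) at_top"
  proof (rule lyapunov_tendsto_0[OF V_deriv f_deriv])
    fix t :: real assume t: "0 \<le> t"
    show "\<alpha> * (e t \<bullet> x' t) + (z t - zs) \<bullet> (?Lm *v l t) \<le> - \<delta> * (f t + g t)"
      using V_bound[OF t] \<delta>(2)[of "norm (e t)" "norm (p t)"] by (simp add: f_def g_def)
    have D: "- ((?R *v e t) \<bullet> D t) \<le> \<theta>1 * f t"
      using Cauchy_Schwarz_ineq2[of "?R *v e t" "D t"]
        mult_mono[OF norm_sel_mat_le[of own "e t"] e_D[of t]]
      by (simp add: f_def power2_eq_square algebra_simps)
    have p: "- ((?R *v e t) \<bullet> p t) \<le> norm (e t) * norm (p t)"
      using Cauchy_Schwarz_ineq2[of "?R *v e t" "p t"]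
        mult_right_mono[OF norm_sel_mat_le[of own "e t"] norm_ge_zero[of "p t"]] by linarith
    have L: "0 \<le> c * (e t \<bullet> (?Ln *v e t))"
      by (intro mult_nonneg_nonneg c kron_laplacian_psd[OF W(1)])
    have amgm: "2 * (norm (e t) * norm (p t)) \<le> f t + g t"
      using sum_squares_bound[of "norm (e t)" "norm (p t)"] by (simp add: f_def g_def)
    have g: "0 \<le> \<theta>1 * g t"
      using \<theta>1 by (simp add: g_def)
    \<comment> \<open>The constant collects \<open>2 * \<theta>1\<close> from the Lipschitz bound
      and 1 from the arithmetic-geometric mean inequality; the Laplacian term \<open>b\<close> only
      helps.\<close>
    have "2 * (- (a + b) - d) \<le> (2 * \<theta>1 + 1) * (f t + g t)"
      if "- a \<le> \<theta>1 * f t" "0 \<le> b" "- d \<le> q" "2 * q \<le> f t + g t" for a b d q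
      using that g by (simp add: algebra_simps)
    from this[OF D L p amgm] show "2 * (e t \<bullet> x' t) \<le> (2 * \<theta>1 + 1) * (f t + g t)"
      unfolding e_x' .
    show "0 \<le> V t" "0 \<le> f t" "0 \<le> g t"
      using \<alpha> by (simp_all add: V_def f_def g_def)
  qed (use \<delta> \<theta>1 in simp_all)
  from tendsto_real_sqrt[OF this] have "((\<lambda>t. norm (e t)) \<longlongrightarrow> 0) at_top"
    by (simp add: f_def)
  then have "(e \<longlongrightarrow> 0) at_top"
    by (rule tendsto_norm_zero_cancel)
  then have "((\<lambda>t. ?R *v e t) \<longlongrightarrow> ?R *v 0) at_top"
    by (intro bounded_linear.tendsto[OF matrix_vector_mul_bounded_linear])
  then have "((\<lambda>t. ?R *v e t + u) \<longlongrightarrow> 0 + u) at_top"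
    by (intro tendsto_intros) simp
  then show ?thesis
    by (simp add: e_def matrix_vector_mult_diff_distrib sel_mat_consensus)
qed

section \<open>Equilibrium, convergence and invariance together\<close>

theorem theorem4p7:
  fixes own :: "'k::finite \<Rightarrow> 'i::finite"
    and J :: "'i \<Rightarrow> real^'k \<Rightarrow> real"
    and G :: "real^'k^'m::finite"
    and h :: "'i \<Rightarrow> real^'m"
    and W :: "real^'i^'i"
    and \<mu> \<theta> \<theta>1 c \<alpha> \<mu>bar :: real
  assumes "CARD('i) \<ge> 2"
    and "\<And>i. C1_in_block own i (J i)"
    and "\<And>i. convex_in_block own i (J i)"
    and "slater G h"
    and "rank G = CARD('m)"
    and "\<mu> > 0" and "\<theta> > 0"
    and "strongly_monotone \<mu> (pseudo_gradient own J)"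
    and "\<theta>-lipschitz_on UNIV (pseudo_gradient own J)"
    and "weighted_graph W" and "connected_graph W"
    and "\<theta>1 \<in> {\<mu>..\<theta>}"
    and "\<theta>1-lipschitz_on UNIV (ext_pseudo_gradient own J)"
    and "c > 0"
    and "c > 1 / eig_second (laplacian W) * ((\<theta> + \<theta>1)\<^sup>2 / (4 * \<mu>) + \<theta>1)"
    and "\<mu>bar = eig_min (Psi_mat \<mu> \<theta> \<theta>1 c (eig_second (laplacian W)) CARD('i))"
    and "\<alpha> > 0"
    and "\<alpha> > (\<theta>1 + c * eig_max (laplacian W))\<^sup>2 / (4 * \<mu>bar)"
  shows "\<exists>xs. is_vGNE own J G h xs \<and> (\<forall>y. is_vGNE own J G h y \<longrightarrow> y = xs) \<and>
    (\<forall>xx. sel_mat own *v xx \<in> feasible_set G h \<longleftrightarrow> xx \<in> aug_feasible_set own G h) \<and>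
    (\<forall>x z l. trajectory own J G h W c \<alpha> x z l \<and> sel_mat own *v x 0 \<in> feasible_set G h \<longrightarrow>
       ((\<lambda>t. sel_mat own *v x t) \<longlongrightarrow> xs) at_top \<and>
       (\<forall>t\<ge>0. sel_mat own *v x t \<in> feasible_set G h))"
proof -
  note card = assms(1) and C1 = assms(2) and conv = assms(3) and slater = assms(4)
    and rank = assms(5) and \<mu> = assms(6) and mono = assms(8) and lip = assms(9)
    and W = assms(10,11) and \<theta>1 = assms(12) and lip_ext = assms(13) and c = assms(14,15)
    and \<mu>bar = assms(16) and \<alpha> = assms(17,18)
  let ?X = "feasible_set G h" and ?F = "pseudo_gradient own J"
  \<comment> \<open>A Slater point makes the set nonempty, as the projection argument requires; the
    multiplier below comes from the rank condition.\<close>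
  have "?X \<noteq> {}"
    using slater unfolding slater_def by (metis empty_iff less_imp_le mem_feasible_set)
  moreover have "\<mu> \<le> \<theta>"
    using \<theta>1 by auto
  ultimately obtain xs where VI: "solves_VI ?X ?F xs"
    using solves_VI_exists[OF convex_feasible_set closed_feasible_set _ mono lip \<mu>] by blast
  obtain m where kkt: "?F xs + transpose G *v m = 0" "0 \<le> m"
    "m \<bullet> ((\<Sum>i\<in>UNIV. h i) - G *v xs) = 0"
    using solves_VI_multiplier[OF rank VI] .
  have "is_vGNE own J G h xs"
    unfolding is_vGNE_def using solves_VI_imp_GNE[OF C1 conv VI] VI by blast
  moreover have "y = xs" if "is_vGNE own J G h y" for y
    using solves_VI_unique[OF mono \<mu> _ VI] that by (simp add: is_vGNE_def)
  \<comment> \<open>The lower bound on \<open>c\<close> enters here, as positive definiteness of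
    \<open>Psi_mat\<close>.\<close>
  moreover have "0 < \<mu>bar"
    unfolding \<mu>bar using \<mu> c(2) by (intro eig_min_Psi_pos eig_second_laplacian_pos[OF W card]) simp_all
  then have "((\<lambda>t. sel_mat own *v x t) \<longlongrightarrow> xs) at_top"
    if "trajectory own J G h W c \<alpha> x z l" for x z l
    using VI that
    by (intro trajectory_converges[OF card mono lip lip_ext W less_imp_le[OF c(1)] \<alpha>(1) \<mu>bar _ \<alpha>(2)
          _ kkt]) (simp_all add: solves_VI_def)
  ultimately show ?thesis
    using sel_mat_feasible_iff trajectory_feasible[OF W(1)] by blast
qed

end
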